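(* Let $(M^t_u)_{(t,u)\in\Delta}$ be a square integrable MAF and, for any $(s,x)\in[0,T]\times E$, let $[M^{s,x}]$ be the quadratic variation of its cadlag version $M^{s,x}$ under $\mathbb{P}^{s,x}$. Then there exists an AF, denoted $([M]^t_u)_{(t,u)\in\Delta}$, which for any $(s,x)\in[0,T]\times E$ has $[M^{s,x}]$ as cadlag version under $\mathbb{P}^{s,x}$.
   Context: Canonical space. $E$ is a Polish space with Borel $\sigma$-field $\mathcal{B}(E)$, $T>0$, and $\Omega=\mathbb{D}(E)$ is the set of functions $[0,T]\to E$ that are right-continuous with left limits and continuous at time $T$; $X_t(\omega)=\omega(t)$; $\mathcal{F}=\sigma(X_r\,|\,r\in[0,T])$; $\mathcal{F}_t=\bigcap_{s\in]t,T]}\sigma(X_r\,|\,r\le s)$ for $t<T$ and $\mathcal{F}_T=\mathcal{F}$; $\mathcal{F}_{t,T}=\sigma(X_r\,|\,r\ge t)$ and, for $0\le t\le u<T$, $\mathcal{F}_{t,u}=\bigcap_{n}\sigma(X_r\,|\,r\in[t,u+\frac1n])$ (times restricted to $[0,T]$). Transition kernel. A function $(s,t,x,A)\mapsto P_{s,t}(x,A)$ from $[0,T]^2\times E\times\mathcal{B}(E)$ to $[0,1]$ such that $(s,x)\mapsto P_{s,t}(x,A)$ is Borel for all $t,A$ (the kernel is "measurable in time", which is assumed throughout), $P_{s,t}(x,\cdot)$ is a probability measure, $P_{s,t}(x,A)=\mathbf{1}_A(x)$ if $t\le s$, and $\int_E P_{s,t}(x,dy)P_{t,u}(y,A)=P_{s,u}(x,A)$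 for $s<t<u$. Canonical Markov class. A fixed family $(\mathbb{P}^{s,x})_{(s,x)\in[0,T]\times E}$ of probability measures on $(\Omega,\mathcal{F})$ associated to such a kernel is given: $\mathbb{P}^{s,x}(X_t\in A)=P_{s,t}(x,A)$ for all $t\in[0,T]$, $A\in\mathcal{B}(E)$, and $\mathbb{P}^{s,x}(X_u\in A|\mathcal{F}_t)=P_{t,u}(X_t,A)$ $\mathbb{P}^{s,x}$-a.s. for all $s\le t\le u$. $\mathcal{F}^{s,x}$ and $\mathcal{F}^{s,x}_t$ are the $\sigma$-fields obtained from $\mathcal{F}$ and $\mathcal{F}_t$ by adding the $\mathbb{P}^{s,x}$-negligible sets. Additive functionals. $\Delta=\{(t,u)\in[0,T]^2\,|\,t\le u\}$. A (non-homogeneous) Additive Functional (AF) is a family of real random variables $A=(A^t_u)_{(t,u)\in\Delta}$ on $(\Omega,\mathcal{F})$ such that (1) $A^t_u$ is $\mathcal{F}_{t,u}$-measurable for every $(t,u)\in\Delta$; (2) for every $(s,x)\in[0,T]\times E$ there is a real cadlag $(\mathcal{F}^{s,x}_t)_{t\in[0,T]}$-adapted process $A^{s,x}$ (taken equal to zero on $[0,s]$) such that for all $s\le t\le u$, $A^t_u=A^{s,x}_u-A^{s,x}_t$ $\mathbb{P}^{s,x}$-a.s. $A^{s,x}$ is called the cadlag version of $A$ under $\mathbb{P}^{s,x}$. A square integrable Martingale Additive Functional (square integrable MAF) is an AF whose cadlag version under every $\mathbb{P}^{s,x}$ is a square integrable martingale. Quadratic variations are taken in the stochastic basis $(\Omega,\mathcal{F}^{s,x},(\mathcal{F}^{s,x}_t)_{t\in[0,T]},\mathbb{P}^{s,x})$.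 *)

theory Defs
  imports "HOL-Probability.Probability"
begin

section \<open>Canonical space\<close>

definition right_cont_left_lim :: "real \<Rightarrow> (real \<Rightarrow> 'a::topological_space) \<Rightarrow> bool" where
  "right_cont_left_lim T f \<longleftrightarrow>
     (\<forall>t\<in>{0..<T}. (f \<longlongrightarrow> f t) (at_right t)) \<and>
     (\<forall>t\<in>{0<..T}. \<exists>l. (f \<longlongrightarrow> l) (at_left t))"

text \<open>A function on \<open>[0,T]\<close> is represented by its unique extension that is \<open>undefined\<close> outside
  \<open>[0,T]\<close>. The second conjunct below is continuity at \<open>T\<close>.\<close>

definition path_space :: "real \<Rightarrow> (real \<Rightarrow> 'e::topological_space) set" where
  "path_space T =
     {\<omega> \<in> extensional {0..T}. right_cont_left_lim T \<omega> \<and> (\<omega> \<longlongrightarrow> \<omega> T) (at_left T)}"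

text \<open>In the \<open>\<sigma>\<close>-fields below, which are given as \<open>measure\<close> objects, only \<open>space\<close> and \<open>sets\<close>
  are relevant. \<open>coord_field T I\<close> is \<open>\<sigma>(X\<^sub>r | r \<in> I)\<close>.\<close>

definition coord_field :: "real \<Rightarrow> real set \<Rightarrow> (real \<Rightarrow> 'e::topological_space) measure" where
  "coord_field T I =
     sigma (path_space T) {{\<omega> \<in> path_space T. \<omega> r \<in> B} | r B. r \<in> I \<and> B \<in> sets borel}"

text \<open>\<open>past_field T t\<close> is \<open>\<F>\<^sub>t\<close> and \<open>window_field T t u\<close> is \<open>\<F>\<^bsub>t,u\<^esub>\<close>.\<close>

definition past_field :: "real \<Rightarrow> real \<Rightarrow> (real \<Rightarrow> 'e::topological_space) measure" where
  "past_field T t =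
     (if t < T then sigma (path_space T) (\<Inter>s\<in>{t<..T}. sets (coord_field T {0..s}))
      else coord_field T {0..T})"

definition window_field ::
    "real \<Rightarrow> real \<Rightarrow> real \<Rightarrow> (real \<Rightarrow> 'e::topological_space) measure" where
  "window_field T t u =
     (if u < T
      then sigma (path_space T) (\<Inter>n. sets (coord_field T ({t..u + 1 / real (Suc n)} \<inter> {0..T})))
      else coord_field T {t..T})"


section \<open>Transition kernels and canonical Markov classes\<close>

text \<open>The measure \<open>P s t x\<close> is \<open>P\<^bsub>s,t\<^esub>(x, \<cdot>)\<close>.\<close>

definition transition_kernel ::
    "real \<Rightarrow> (real \<Rightarrow> real \<Rightarrow> 'e::polish_space \<Rightarrow> 'e measure) \<Rightarrow> bool" where
  "transition_kernel T P \<longleftrightarrow>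
     (\<forall>s\<in>{0..T}. \<forall>t\<in>{0..T}. \<forall>x. prob_space (P s t x) \<and> sets (P s t x) = sets borel) \<and>
     (\<forall>t\<in>{0..T}. \<forall>A\<in>sets borel.
        (\<lambda>(s, x). measure (P s t x) A) \<in> borel_measurable (restrict_space borel ({0..T} \<times> UNIV))) \<and>
     (\<forall>s\<in>{0..T}. \<forall>t\<in>{0..T}. \<forall>x. \<forall>A\<in>sets borel. t \<le> s \<longrightarrow> measure (P s t x) A = indicator A x) \<and>
     (\<forall>s\<in>{0..T}. \<forall>t\<in>{0..T}. \<forall>u\<in>{0..T}. \<forall>x. \<forall>A\<in>sets borel. s < t \<and> t < u \<longrightarrow>
        (\<integral>y. measure (P t u y) A \<partial>(P s t x)) = measure (P s u x) A)"

definition canonical_markov_class ::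
    "real \<Rightarrow> (real \<Rightarrow> real \<Rightarrow> 'e::polish_space \<Rightarrow> 'e measure) \<Rightarrow>
     (real \<Rightarrow> 'e \<Rightarrow> (real \<Rightarrow> 'e) measure) \<Rightarrow> bool" where
  "canonical_markov_class T P \<PP> \<longleftrightarrow>
     (\<forall>s\<in>{0..T}. \<forall>x.
        prob_space (\<PP> s x) \<and>
        space (\<PP> s x) = path_space T \<and>
        sets (\<PP> s x) = sets (coord_field T {0..T}) \<and>
        (\<forall>t\<in>{0..T}. \<forall>A\<in>sets borel.
           measure (\<PP> s x) {\<omega> \<in> path_space T. \<omega> t \<in> A} = measure (P s t x) A) \<and>
        (\<forall>t u. \<forall>A\<in>sets borel. s \<le> t \<and> t \<le> u \<and> u \<le> T \<longrightarrow>
           (AE \<omega> in \<PP> s x.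
              real_cond_exp (\<PP> s x) (past_field T t) (indicator {\<omega> \<in> path_space T. \<omega> u \<in> A}) \<omega>
              = measure (P t u (\<omega> t)) A)))"


section \<open>Martingales and quadratic variation\<close>

definition adapted_cadlag ::
    "real \<Rightarrow> 'a measure \<Rightarrow> (real \<Rightarrow> 'a measure) \<Rightarrow> (real \<Rightarrow> 'a \<Rightarrow> real) \<Rightarrow> bool" where
  "adapted_cadlag T M F Y \<longleftrightarrow>
     (\<forall>t\<in>{0..T}. Y t \<in> borel_measurable (F t)) \<and>
     (\<forall>\<omega>\<in>space M. right_cont_left_lim T (\<lambda>t. Y t \<omega>))"

definition square_integrable_martingale ::
    "real \<Rightarrow> 'a measure \<Rightarrow> (real \<Rightarrow> 'a measure) \<Rightarrow> (real \<Rightarrow> 'a \<Rightarrow> real) \<Rightarrow> bool" where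
  "square_integrable_martingale T M F Y \<longleftrightarrow>
     (\<forall>t\<in>{0..T}. Y t \<in> borel_measurable (F t) \<and> integrable M (Y t) \<and> integrable M (\<lambda>\<omega>. (Y t \<omega>)\<^sup>2)) \<and>
     (\<forall>t u. 0 \<le> t \<and> t \<le> u \<and> u \<le> T \<longrightarrow> (AE \<omega> in M. real_cond_exp M (F t) (Y u) \<omega> = Y t \<omega>))"

definition tends_in_prob :: "'a measure \<Rightarrow> (nat \<Rightarrow> 'a \<Rightarrow> real) \<Rightarrow> ('a \<Rightarrow> real) \<Rightarrow> bool" where
  "tends_in_prob M S Z \<longleftrightarrow>
     (\<forall>\<epsilon>>0. (\<lambda>n. measure M {\<omega> \<in> space M. \<bar>S n \<omega> - Z \<omega>\<bar> > \<epsilon>}) \<longlonglongrightarrow> 0)"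

text \<open>The \<open>n\<close>-th subdivision consists of the points \<open>\<tau> n 0 < \<dots> < \<tau> n (k n)\<close>.\<close>

definition vanishing_subdivisions ::
    "real \<Rightarrow> real \<Rightarrow> (nat \<Rightarrow> nat) \<Rightarrow> (nat \<Rightarrow> nat \<Rightarrow> real) \<Rightarrow> bool" where
  "vanishing_subdivisions a b k \<tau> \<longleftrightarrow>
     (\<forall>n. \<tau> n 0 = a \<and> \<tau> n (k n) = b \<and> (\<forall>i<k n. \<tau> n i < \<tau> n (Suc i))) \<and>
     (\<forall>\<delta>>0. \<forall>\<^sub>F n in sequentially. \<forall>i<k n. \<tau> n (Suc i) - \<tau> n i < \<delta>)"

text \<open>\<open>[Y]\<close> is the adapted cadlag process whose value at each time \<open>t\<close> is the limit in probability
  of the sums of squared increments of \<open>Y\<close> along subdivisions of \<open>[0,t]\<close> with vanishing mesh.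
  This determines \<open>[Y]\<close> up to indistinguishability, and its value at time \<open>0\<close> is null
  almost surely (\<open>Y 0\<close> does not contribute).\<close>

definition is_quadratic_variation ::
    "real \<Rightarrow> 'a measure \<Rightarrow> (real \<Rightarrow> 'a measure) \<Rightarrow> (real \<Rightarrow> 'a \<Rightarrow> real) \<Rightarrow> (real \<Rightarrow> 'a \<Rightarrow> real) \<Rightarrow> bool"
  where
  "is_quadratic_variation T M F Y Q \<longleftrightarrow>
     adapted_cadlag T M F Q \<and>
     (\<forall>t\<in>{0..T}. \<forall>k \<tau>. vanishing_subdivisions 0 t k \<tau> \<longrightarrow>
        tends_in_prob M (\<lambda>n \<omega>. \<Sum>i<k n. (Y (\<tau> n (Suc i)) \<omega> - Y (\<tau> n i) \<omega>)\<^sup>2) (Q t))"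


section \<open>Additive functionals\<close>

text \<open>The stochastic basis \<open>(\<Omega>, \<F>\<^bsup>s,x\<^esup>, (\<F>\<^bsup>s,x\<^esup>\<^sub>t), \<P>\<^bsup>s,x\<^esup>)\<close> is given by \<open>completion P\<close> and
  \<open>augmented_field T P\<close> for \<open>P = \<P>\<^bsup>s,x\<^esup>\<close>.\<close>

definition augmented_field ::
    "real \<Rightarrow> (real \<Rightarrow> 'e::topological_space) measure \<Rightarrow> real \<Rightarrow> (real \<Rightarrow> 'e) measure" where
  "augmented_field T P t =
     sigma (path_space T) (sets (past_field T t) \<union> null_sets (completion P))"

text \<open>\<open>A t u\<close> is \<open>A\<^sup>t\<^sub>u\<close>, only meaningful for \<open>0 \<le> t \<le> u \<le> T\<close>. As processes are considered up to
  indistinguishability, a cadlag version is asked to vanish on \<open>[0,s]\<close> almost surely.\<close>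

definition is_cadlag_version ::
    "real \<Rightarrow> (real \<Rightarrow> 'e \<Rightarrow> (real \<Rightarrow> 'e::polish_space) measure) \<Rightarrow> real \<Rightarrow> 'e \<Rightarrow>
     (real \<Rightarrow> real \<Rightarrow> (real \<Rightarrow> 'e) \<Rightarrow> real) \<Rightarrow> (real \<Rightarrow> (real \<Rightarrow> 'e) \<Rightarrow> real) \<Rightarrow> bool" where
  "is_cadlag_version T \<PP> s x A Y \<longleftrightarrow>
     adapted_cadlag T (completion (\<PP> s x)) (augmented_field T (\<PP> s x)) Y \<and>
     (AE \<omega> in completion (\<PP> s x). \<forall>u\<in>{0..s}. Y u \<omega> = 0) \<and>
     (\<forall>t u. s \<le> t \<and> t \<le> u \<and> u \<le> T \<longrightarrow>
        (AE \<omega> in completion (\<PP> s x). A t u \<omega> = Y u \<omega> - Y t \<omega>))"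

definition additive_functional ::
    "real \<Rightarrow> (real \<Rightarrow> 'e \<Rightarrow> (real \<Rightarrow> 'e::polish_space) measure) \<Rightarrow>
     (real \<Rightarrow> real \<Rightarrow> (real \<Rightarrow> 'e) \<Rightarrow> real) \<Rightarrow> bool" where
  "additive_functional T \<PP> A \<longleftrightarrow>
     (\<forall>t u. 0 \<le> t \<and> t \<le> u \<and> u \<le> T \<longrightarrow> A t u \<in> borel_measurable (window_field T t u)) \<and>
     (\<forall>s\<in>{0..T}. \<forall>x. \<exists>Y. is_cadlag_version T \<PP> s x A Y)"

definition square_integrable_MAF ::
    "real \<Rightarrow> (real \<Rightarrow> 'e \<Rightarrow> (real \<Rightarrow> 'e::polish_space) measure) \<Rightarrow>
     (real \<Rightarrow> real \<Rightarrow> (real \<Rightarrow> 'e) \<Rightarrow> real) \<Rightarrow> bool" where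
  "square_integrable_MAF T \<PP> M \<longleftrightarrow>
     additive_functional T \<PP> M \<and>
     (\<forall>s\<in>{0..T}. \<forall>x. \<forall>Y. is_cadlag_version T \<PP> s x M Y \<longrightarrow>
        square_integrable_martingale T (completion (\<PP> s x)) (augmented_field T (\<PP> s x)) Y)"

end

theory Submission
  imports Defs
begin

text \<open>Under \<open>\<PP>\<^sup>s\<^sup>,\<^sup>x\<close> with \<open>s \<le> t \<le> u\<close>, the increment of \<open>[M\<^sup>s\<^sup>,\<^sup>x]\<close> between \<open>t\<close> and \<open>u\<close> is the limit in
  probability of the sums \<open>S\<^sub>n\<close> of the squares of the increments of \<open>M\<^sup>s\<^sup>,\<^sup>x\<close> along subdivisions of
  \<open>[t,u]\<close> (lemma \<open>quadratic_variation_increment\<close>). Almost surely these increments are values of the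
  additive functional \<open>M\<close>, so that \<open>S\<^sub>n\<close> can be taken independent of \<open>(s,x)\<close> and measurable with
  respect to \<open>\<F>\<^bsub>t,u\<^esub>\<close>. What has to be found is one \<open>\<F>\<^bsub>t,u\<^esub>\<close>-measurable variable that is the limit under
  all these laws simultaneously (lemma \<open>common_limit_in_prob\<close>).

  An almost sure limit requires a subsequence that depends on the law. Consider first the laws
  \<open>\<PP>\<^sup>t\<^sup>,\<^sup>y\<close> that start at time \<open>t\<close>, and let \<open>r\<^sub>k(y)\<close> be the first index from which on \<open>S\<^sub>m\<close> remains
  within \<open>2\<^sup>-\<^sup>k\<close> of the term with this index, up to an event of \<open>\<PP>\<^sup>t\<^sup>,\<^sup>y\<close>-probability \<open>2\<^sup>-\<^sup>k\<close> for each \<open>m\<close>. By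
  Borel--Cantelli \<open>S\<^sub>n\<close> converges \<open>\<PP>\<^sup>t\<^sup>,\<^sup>y\<close>-almost surely along \<open>r\<^sub>k(y)\<close>. Since \<open>X\<^sub>t = y\<close> almost surely
  under \<open>\<PP>\<^sup>t\<^sup>,\<^sup>y\<close>, the variable \<open>Z\<close> that is the limit of \<open>S\<^sub>n\<close> along \<open>r\<^sub>k(X\<^sub>t)\<close> works for every \<open>y\<close>; and it is
  \<open>\<F>\<^bsub>t,u\<^esub>\<close>-measurable because \<open>r\<^sub>k\<close> is a measurable function.

  Both the measurability of \<open>r\<^sub>k\<close> and the passage to earlier starting times rest on the Markov property
  for the events \<open>F\<close> of \<open>\<sigma>(X\<^sub>r | r \<ge> t)\<close> (lemma \<open>markov_coord_field\<close>): \<open>\<PP>\<^sup>t\<^sup>,\<^sup>y(F)\<close> is measurable in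
  \<open>y\<close>, and \<open>\<PP>\<^sup>s\<^sup>,\<^sup>x(F)\<close> is its integral against \<open>P\<^bsub>s,t\<^esub>(x, dy)\<close>. Applied to the events
  \<open>\<bar>S\<^sub>n - Z\<bar> > \<epsilon>\<close>, this identity and dominated convergence show that \<open>S\<^sub>n\<close> tends to \<open>Z\<close> in
  \<open>\<PP>\<^sup>s\<^sup>,\<^sup>x\<close>-probability for all \<open>s \<le> t\<close>, whence \<open>Z\<close> is the increment of \<open>[M\<^sup>s\<^sup>,\<^sup>x]\<close> almost surely.

  It remains that \<open>[M\<^sup>s\<^sup>,\<^sup>x]\<close> vanishes on \<open>[0,s]\<close>, as \<open>M\<^sup>s\<^sup>,\<^sup>x\<close> does.\<close>


section \<open>Convergence in probability\<close>

context prob_space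
begin

lemma tends_in_prob_triangle:
  assumes [measurable]: "f \<in> borel_measurable M" "g \<in> borel_measurable M" "h \<in> borel_measurable M"
  assumes "c \<ge> a + b"
  shows "prob {\<omega> \<in> space M. \<bar>f \<omega> - h \<omega> :: real\<bar> > c}
    \<le> prob {\<omega> \<in> space M. \<bar>f \<omega> - g \<omega>\<bar> > a} + prob {\<omega> \<in> space M. \<bar>g \<omega> - h \<omega>\<bar> > b}"
proof -
  have "prob {\<omega> \<in> space M. \<bar>f \<omega> - h \<omega>\<bar> > c}
      \<le> prob ({\<omega> \<in> space M. \<bar>f \<omega> - g \<omega>\<bar> > a} \<union> {\<omega> \<in> space M. \<bar>g \<omega> - h \<omega>\<bar> > b})"
    using assms(4) by (intro finite_measure_mono) auto
  also have "\<dots> \<le> prob {\<omega> \<in> space M. \<bar>f \<omega> - g \<omega>\<bar> > a} + prob {\<omega> \<in> space M. \<bar>g \<omega> - h \<omega>\<bar> > b}"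
    by (rule measure_Un_le) auto
  finally show ?thesis .
qed

lemma tends_in_prob_diff:
  assumes [measurable]: "\<And>n. S n \<in> borel_measurable M" "\<And>n. S' n \<in> borel_measurable M"
    "Z \<in> borel_measurable M" "Z' \<in> borel_measurable M"
  assumes S: "tends_in_prob M S Z" and S': "tends_in_prob M S' Z'"
  shows "tends_in_prob M (\<lambda>n \<omega>. S n \<omega> - S' n \<omega>) (\<lambda>\<omega>. Z \<omega> - Z' \<omega>)"
  unfolding tends_in_prob_def
proof (intro allI impI)
  fix e :: real assume "e > 0"
  then have lim: "(\<lambda>n. prob {\<omega> \<in> space M. \<bar>S n \<omega> - Z \<omega>\<bar> > e / 2}
      + prob {\<omega> \<in> space M. \<bar>S' n \<omega> - Z' \<omega>\<bar> > e / 2}) \<longlonglongrightarrow> 0 + 0"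
    using S S' half_gt_zero[of e] unfolding tends_in_prob_def by (intro tendsto_add) blast+
  have *: "\<bar>a - c\<bar> > e / 2 \<or> \<bar>b - d\<bar> > e / 2" if "\<bar>a - b - (c - d)\<bar> > e" for a b c d
    using that abs_triangle_ineq4[of "a - c" "b - d"] by (simp add: algebra_simps) argo
  have "prob {\<omega> \<in> space M. \<bar>S n \<omega> - S' n \<omega> - (Z \<omega> - Z' \<omega>)\<bar> > e}
      \<le> prob {\<omega> \<in> space M. \<bar>S n \<omega> - Z \<omega>\<bar> > e / 2}
       + prob {\<omega> \<in> space M. \<bar>S' n \<omega> - Z' \<omega>\<bar> > e / 2}" for n
  proof -
    have "prob {\<omega> \<in> space M. \<bar>S n \<omega> - S' n \<omega> - (Z \<omega> - Z' \<omega>)\<bar> > e}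
      \<le> prob ({\<omega> \<in> space M. \<bar>S n \<omega> - Z \<omega>\<bar> > e / 2} \<union> {\<omega> \<in> space M. \<bar>S' n \<omega> - Z' \<omega>\<bar> > e / 2})"
      by (intro finite_measure_mono subsetI, use * in blast, measurable)
    also have "\<dots> \<le> prob {\<omega> \<in> space M. \<bar>S n \<omega> - Z \<omega>\<bar> > e / 2}
       + prob {\<omega> \<in> space M. \<bar>S' n \<omega> - Z' \<omega>\<bar> > e / 2}"
      by (rule measure_Un_le) auto
    finally show ?thesis .
  qed
  then have bound: "\<forall>n. norm (prob {\<omega> \<in> space M. \<bar>S n \<omega> - S' n \<omega> - (Z \<omega> - Z' \<omega>)\<bar> > e})
      \<le> prob {\<omega> \<in> space M. \<bar>S n \<omega> - Z \<omega>\<bar> > e / 2}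
       + prob {\<omega> \<in> space M. \<bar>S' n \<omega> - Z' \<omega>\<bar> > e / 2}"
    by simp
  show "(\<lambda>n. prob {\<omega> \<in> space M. \<bar>S n \<omega> - S' n \<omega> - (Z \<omega> - Z' \<omega>)\<bar> > e}) \<longlonglongrightarrow> 0"
    using Lim_null_comparison[OF always_eventually[OF bound]] lim by simp
qed

lemma tends_in_prob_unique:
  assumes S[measurable]: "\<And>n. S n \<in> borel_measurable M"
    "Z \<in> borel_measurable M" "Z' \<in> borel_measurable M"
  assumes "tends_in_prob M S Z" and "tends_in_prob M S Z'"
  shows "AE \<omega> in M. Z \<omega> = Z' \<omega>"
proof -
  have null: "prob {\<omega> \<in> space M. \<bar>Z \<omega> - Z' \<omega>\<bar> > e} = 0" if "e > 0" for e
  proof -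
    have "(\<lambda>n::nat. prob {\<omega> \<in> space M. \<bar>Z \<omega> - Z' \<omega>\<bar> > e}) \<longlonglongrightarrow> 0"
      using tends_in_prob_diff[OF S(1) S(1) S(2,3) assms(4,5)] that
      by (simp add: tends_in_prob_def abs_minus_commute)
    then show ?thesis by (simp add: LIMSEQ_const_iff)
  qed
  have "AE \<omega> in M. \<bar>Z \<omega> - Z' \<omega>\<bar> \<le> 1 / real (Suc n)" for n
    using null[of "1 / real (Suc n)"]
    by (subst AE_iff_measurable[OF _ refl]) (auto simp: not_le emeasure_eq_measure)
  then have "AE \<omega> in M. \<forall>n. \<bar>Z \<omega> - Z' \<omega>\<bar> \<le> 1 / real (Suc n)"
    by (simp add: AE_all_countable)
  then show ?thesis
  proof eventually_elim
    case (elim \<omega>)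
    have "\<bar>Z \<omega> - Z' \<omega>\<bar> \<le> 0"
      using elim by (intro LIMSEQ_le_const[OF LIMSEQ_inverse_real_of_nat])
        (auto simp: inverse_eq_divide)
    then show ?case by simp
  qed
qed

lemma tends_in_prob_AE_cong:
  assumes [measurable]: "\<And>n. S n \<in> borel_measurable M" "\<And>n. S' n \<in> borel_measurable M"
    "Z \<in> borel_measurable M" "Z' \<in> borel_measurable M"
  assumes "\<And>n. AE \<omega> in M. S n \<omega> = S' n \<omega>" "AE \<omega> in M. Z \<omega> = Z' \<omega>"
    and "tends_in_prob M S Z"
  shows "tends_in_prob M S' Z'"
proof -
  have "prob {\<omega> \<in> space M. \<bar>S n \<omega> - Z \<omega>\<bar> > e} = prob {\<omega> \<in> space M. \<bar>S' n \<omega> - Z' \<omega>\<bar> > e}"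
    for n e
    using assms(5)[of n] assms(6) by (intro finite_measure_eq_AE) auto
  then show ?thesis using assms(7) by (simp add: tends_in_prob_def)
qed

text \<open>The bound is stated with the same number \<open>e\<close> as distance and as probability, because the
  choice of a subsequence below needs one threshold per index.\<close>

lemma tends_in_prob_Cauchy:
  assumes [measurable]: "\<And>n. S n \<in> borel_measurable M" "Q \<in> borel_measurable M"
  assumes lim: "tends_in_prob M S Q" and "e > 0"
  shows "\<exists>n. \<forall>m\<ge>n. prob {\<omega> \<in> space M. \<bar>S m \<omega> - S n \<omega>\<bar> > e} \<le> e"
proof -
  have "\<forall>\<^sub>F n in sequentially. prob {\<omega> \<in> space M. \<bar>S n \<omega> - Q \<omega>\<bar> > e / 2} < e / 2"
    using lim half_gt_zero[OF \<open>e > 0\<close>] unfolding tends_in_prob_def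
    by (intro order_tendstoD(2)[where y = 0]) blast+
  then obtain n where n: "\<And>m. m \<ge> n \<Longrightarrow> prob {\<omega> \<in> space M. \<bar>S m \<omega> - Q \<omega>\<bar> > e / 2} < e / 2"
    by (auto simp: eventually_sequentially)
  have "prob {\<omega> \<in> space M. \<bar>S m \<omega> - S n \<omega>\<bar> > e} \<le> e" if "m \<ge> n" for m
  proof -
    have "prob {\<omega> \<in> space M. \<bar>S m \<omega> - S n \<omega>\<bar> > e}
        \<le> prob {\<omega> \<in> space M. \<bar>S m \<omega> - Q \<omega>\<bar> > e / 2} + prob {\<omega> \<in> space M. \<bar>Q \<omega> - S n \<omega>\<bar> > e / 2}"
      by (rule tends_in_prob_triangle) auto
    then show ?thesis using n[OF that] n[of n] by (simp add: abs_minus_commute)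
  qed
  then show ?thesis by blast
qed

text \<open>The hypothesis \<open>fast\<close> only speaks of the terms of the sequence, not of the limit. This is what
  allows the indices \<open>r k\<close> to be chosen later as measurable functions of the law. Letting \<open>m\<close> tend to
  infinity replaces \<open>S m\<close> by \<open>Q\<close> at the cost of another \<open>(1/2) ^ k\<close>, and Borel--Cantelli applies.\<close>

lemma tends_in_prob_fast_subseq:
  assumes [measurable]: "\<And>n. S n \<in> borel_measurable M" "Q \<in> borel_measurable M"
  assumes lim: "tends_in_prob M S Q"
    and fast: "\<And>k m. m \<ge> r k \<Longrightarrow>
      prob {\<omega> \<in> space M. \<bar>S m \<omega> - S (r k) \<omega>\<bar> > (1/2) ^ k} \<le> (1/2) ^ k"
  shows "AE \<omega> in M. (\<lambda>k. S (r k) \<omega>) \<longlonglongrightarrow> Q \<omega>"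
proof -
  define B where "B k = {\<omega> \<in> space M. \<bar>S (r k) \<omega> - Q \<omega>\<bar> > 2 * (1/2) ^ k}" for k
  have [measurable]: "B k \<in> sets M" for k unfolding B_def by measurable
  have B: "prob (B k) \<le> (1/2) ^ k" for k
  proof -
    have "(\<lambda>m. (1/2) ^ k + prob {\<omega> \<in> space M. \<bar>S m \<omega> - Q \<omega>\<bar> > (1/2) ^ k}) \<longlonglongrightarrow> (1/2) ^ k + 0"
      using lim by (intro tendsto_add tendsto_const) (auto simp: tends_in_prob_def)
    moreover have "prob (B k) \<le> (1/2) ^ k + prob {\<omega> \<in> space M. \<bar>S m \<omega> - Q \<omega>\<bar> > (1/2) ^ k}"
      if "m \<ge> r k" for m
    proof -
      have "prob (B k) \<le> prob {\<omega> \<in> space M. \<bar>S (r k) \<omega> - S m \<omega>\<bar> > (1/2) ^ k}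
          + prob {\<omega> \<in> space M. \<bar>S m \<omega> - Q \<omega>\<bar> > (1/2) ^ k}"
        unfolding B_def by (rule tends_in_prob_triangle) auto
      then show ?thesis using fast[OF that] by (simp add: abs_minus_commute)
    qed
    ultimately show ?thesis by (intro LIMSEQ_le_const) auto
  qed
  have "AE \<omega> in M. eventually (\<lambda>k. \<omega> \<in> space M - B k) sequentially"
  proof (rule borel_cantelli_AE1)
    show "summable (\<lambda>k. prob (B k))"
      by (rule summable_comparison_test'[of "\<lambda>k. (1/2) ^ k"]) (auto simp: B)
  qed (auto simp: emeasure_eq_measure)
  then show ?thesis
  proof eventually_elim
    case (elim \<omega>)
    then have "\<forall>\<^sub>F k in sequentially. norm (S (r k) \<omega> - Q \<omega>) \<le> 2 * (1/2) ^ k"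
      by eventually_elim (auto simp: B_def)
    moreover have "(\<lambda>k. 2 * (1/2) ^ k :: real) \<longlonglongrightarrow> 0"
      by (intro tendsto_mult_right_zero LIMSEQ_power_zero) auto
    ultimately have "(\<lambda>k. S (r k) \<omega> - Q \<omega>) \<longlonglongrightarrow> 0"
      by (rule Lim_null_comparison)
    then show ?case by (simp add: LIM_zero_iff)
  qed
qed

lemma tends_in_prob_completion_iff:
  assumes [measurable]: "\<And>n. S n \<in> borel_measurable M" "Z \<in> borel_measurable M"
  shows "tends_in_prob (completion M) S Z \<longleftrightarrow> tends_in_prob M S Z"
proof -
  have "measure (completion M) {\<omega> \<in> space M. \<bar>S n \<omega> - Z \<omega>\<bar> > e}
      = prob {\<omega> \<in> space M. \<bar>S n \<omega> - Z \<omega>\<bar> > e}" for n e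
    by (rule measure_completion) measurable
  then show ?thesis by (simp add: tends_in_prob_def)
qed

end


section \<open>The fields generated by the coordinates\<close>

lemma coord_field_gen_subset:
  "{{\<omega> \<in> path_space T. \<omega> r \<in> B} | r B. r \<in> I \<and> B \<in> sets borel} \<subseteq> Pow (path_space T)"
  by auto

lemma space_coord_field [simp]: "space (coord_field T I) = path_space T"
  by (simp add: coord_field_def space_measure_of_conv)

lemma sets_coord_field:
  "sets (coord_field T I) =
    sigma_sets (path_space T) {{\<omega> \<in> path_space T. \<omega> r \<in> B} | r B. r \<in> I \<and> B \<in> sets borel}"
  unfolding coord_field_def by (rule sets_measure_of[OF coord_field_gen_subset])

lemma cylinder_in_coord_field:
  "r \<in> I \<Longrightarrow> B \<in> sets borel \<Longrightarrow> {\<omega> \<in> path_space T. \<omega> r \<in> B} \<in> sets (coord_field T I)"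
  unfolding sets_coord_field by (rule sigma_sets.Basic) auto

lemma coord_field_mono: "I \<subseteq> J \<Longrightarrow> sets (coord_field T I) \<subseteq> sets (coord_field T J)"
  unfolding sets_coord_field by (rule sigma_sets_mono') auto

lemma space_past_field [simp]: "space (past_field T t) = path_space T"
  by (simp add: past_field_def space_measure_of_conv)

lemma space_window_field [simp]: "space (window_field T t u) = path_space T"
  by (simp add: window_field_def space_measure_of_conv)

lemma coord_field_into_space: "sets (coord_field T I) \<subseteq> Pow (path_space T)"
  using sets.space_closed[of "coord_field T I"] by simp

lemma sets_past_field:
  assumes "t < T"
  shows "sets (past_field T t) =
    sigma_sets (path_space T) (\<Inter>s\<in>{t<..T}. sets (coord_field T {0..s}))"
proof -
  have "(\<Inter>s\<in>{t<..T}. sets (coord_field T {0..s})) \<subseteq> Pow (path_space T)"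
    using assms by (intro subset_trans[OF INF_lower[of T] coord_field_into_space]) simp
  from sets_measure_of[OF this] show ?thesis using assms by (simp add: past_field_def del: of_nat_Suc)
qed

lemma sets_window_field:
  assumes "u < T"
  shows "sets (window_field T t u) =
    sigma_sets (path_space T) (\<Inter>n. sets (coord_field T ({t..u + 1 / real (Suc n)} \<inter> {0..T})))"
proof -
  have "(\<Inter>n. sets (coord_field T ({t..u + 1 / real (Suc n)} \<inter> {0..T}))) \<subseteq> Pow (path_space T)"
    by (rule subset_trans[OF INF_lower[of 0] coord_field_into_space]) simp
  from sets_measure_of[OF this] show ?thesis using assms by (simp add: window_field_def del: of_nat_Suc)
qed

lemma past_field_le: "sets (past_field T t) \<subseteq> sets (coord_field T {0..T})"
proof (cases "t < T")
  case True
  have "sigma_sets (space (coord_field T {0..T})) (\<Inter>s\<in>{t<..T}. sets (coord_field T {0..s}))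
      \<subseteq> sets (coord_field T {0..T})"
    using True by (intro sets.sigma_sets_subset) auto
  then show ?thesis using True by (simp add: sets_past_field)
qed (simp add: past_field_def)

lemma past_field_mono:
  assumes "s \<le> t" shows "sets (past_field T s) \<subseteq> sets (past_field T t)"
proof (cases "t < T")
  case True
  then show ?thesis using assms
    by (simp add: sets_past_field) (intro sigma_sets_mono', auto)
next
  case False
  then show ?thesis using past_field_le[of T s] by (simp add: past_field_def)
qed

lemma cylinder_in_past_field:
  assumes "0 \<le> t" "t \<le> T" "B \<in> sets borel"
  shows "{\<omega> \<in> path_space T. \<omega> t \<in> B} \<in> sets (past_field T t)"
proof (cases "t < T")
  case True
  then show ?thesis using assms
    by (simp add: sets_past_field, intro sigma_sets.Basic) (auto intro!: cylinder_in_coord_field)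
next
  case False
  then show ?thesis using assms by (auto simp: past_field_def intro!: cylinder_in_coord_field)
qed

lemma window_field_le:
  assumes "0 \<le> t" "u \<le> T"
  shows "sets (window_field T t u) \<subseteq> sets (coord_field T {t..T})"
proof (cases "u < T")
  case True
  obtain n where n: "1 / real (Suc n) < T - u"
    using True nat_approx_posE[of "T - u"] by auto
  have "(\<Inter>n. sets (coord_field T ({t..u + 1 / real (Suc n)} \<inter> {0..T}))) \<subseteq>
     sets (coord_field T ({t..u + 1 / real (Suc n)} \<inter> {0..T}))" by auto
  also have "\<dots> \<subseteq> sets (coord_field T {t..T})" using n by (intro coord_field_mono) auto
  finally have "sigma_sets (space (coord_field T {t..T}))
      (\<Inter>n. sets (coord_field T ({t..u + 1 / real (Suc n)} \<inter> {0..T}))) \<subseteq> sets (coord_field T {t..T})"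
    by (intro sets.sigma_sets_subset)
  then show ?thesis using True by (simp add: sets_window_field)
next
  case False
  then show ?thesis by (simp add: window_field_def)
qed

lemma window_field_mono:
  assumes "0 \<le> t" "t \<le> t'" "u' \<le> u" "u \<le> T"
  shows "sets (window_field T t' u') \<subseteq> sets (window_field T t u)"
proof (cases "u < T")
  case True
  then have "u' < T" using \<open>u' \<le> u\<close> by (rule le_less_trans[rotated])
  have *: "sets (coord_field T ({t'..u' + 1 / real (Suc n)} \<inter> {0..T})) \<subseteq>
     sets (coord_field T ({t..u + 1 / real (Suc n)} \<inter> {0..T}))" for n
  proof (rule coord_field_mono, rule subsetI)
    fix r assume "r \<in> {t'..u' + 1 / real (Suc n)} \<inter> {0..T}"
    then show "r \<in> {t..u + 1 / real (Suc n)} \<inter> {0..T}"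
      using assms(2,3) by (simp del: of_nat_Suc)
  qed
  have "(\<Inter>n. sets (coord_field T ({t'..u' + 1 / real (Suc n)} \<inter> {0..T})))
      \<subseteq> (\<Inter>n. sets (coord_field T ({t..u + 1 / real (Suc n)} \<inter> {0..T})))"
    by (rule INF_mono') (rule *)
  then show ?thesis
    unfolding sets_window_field[OF True] sets_window_field[OF \<open>u' < T\<close>]
    by (rule sigma_sets_mono')
next
  case False
  then have "sets (window_field T t u) = sets (coord_field T {t..T})"
    by (simp add: window_field_def)
  moreover have "sets (coord_field T {t'..T}) \<subseteq> sets (coord_field T {t..T})"
    using assms by (intro coord_field_mono) auto
  ultimately show ?thesis using window_field_le[of t' u' T] assms by auto
qed

lemma cylinder_in_window_field:
  assumes "0 \<le> t" "t \<le> u" "u \<le> T" "B \<in> sets borel"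
  shows "{\<omega> \<in> path_space T. \<omega> t \<in> B} \<in> sets (window_field T t u)"
proof (cases "u < T")
  case True
  have "t \<in> {t..u + 1 / real (Suc n)} \<inter> {0..T}" for n
  proof -
    have "0 \<le> 1 / real (Suc n)" by simp
    then have "t \<le> u + 1 / real (Suc n)" using assms by linarith
    then show ?thesis using assms by simp
  qed
  from cylinder_in_coord_field[OF this assms(4)]
  have "{\<omega> \<in> path_space T. \<omega> t \<in> B}
      \<in> (\<Inter>n. sets (coord_field T ({t..u + 1 / real (Suc n)} \<inter> {0..T})))"
    by blast
  then show ?thesis
    unfolding sets_window_field[OF True] by (rule sigma_sets.Basic)
next
  case False
  have "t \<in> {t..T}" using assms by simp
  from cylinder_in_coord_field[OF this assms(4)] show ?thesis
    using False by (simp add: window_field_def)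
qed

lemma measurable_coord_window_field:
  assumes "0 \<le> t" "t \<le> u" "u \<le> T"
  shows "(\<lambda>\<omega>. \<omega> t) \<in> window_field T t u \<rightarrow>\<^sub>M borel"
  using cylinder_in_window_field[OF assms]
  by (intro measurableI) (simp_all add: vimage_def Int_def conj_commute)


section \<open>The Markov property on the future of a time\<close>

locale markov_class =
  fixes T :: real
    and P :: "real \<Rightarrow> real \<Rightarrow> 'e::polish_space \<Rightarrow> 'e measure"
    and \<PP> :: "real \<Rightarrow> 'e \<Rightarrow> (real \<Rightarrow> 'e) measure"
  assumes kernel: "transition_kernel T P"
    and markov: "canonical_markov_class T P \<PP>"
begin

lemma prob_space_kernel: "s \<in> {0..T} \<Longrightarrow> t \<in> {0..T} \<Longrightarrow> prob_space (P s t x)"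
  and sets_kernel: "s \<in> {0..T} \<Longrightarrow> t \<in> {0..T} \<Longrightarrow> sets (P s t x) = sets borel"
  using kernel unfolding transition_kernel_def by blast+

lemma prob_space_PP: "s \<in> {0..T} \<Longrightarrow> prob_space (\<PP> s x)"
  and space_PP: "s \<in> {0..T} \<Longrightarrow> space (\<PP> s x) = path_space T"
  and sets_PP: "s \<in> {0..T} \<Longrightarrow> sets (\<PP> s x) = sets (coord_field T {0..T})"
  using markov unfolding canonical_markov_class_def by blast+

lemma sets_PP_if_coord_field:
  assumes "s \<in> {0..T}" "0 \<le> t" "A \<in> sets (coord_field T {t..T})"
  shows "A \<in> sets (\<PP> s x)"
  using assms coord_field_mono[of "{t..T}" "{0..T}" T] by (auto simp: sets_PP)

lemma measurable_kernel:
  assumes s: "s \<in> {0..T}" and t: "t \<in> {0..T}"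
  shows "P s t \<in> borel \<rightarrow>\<^sub>M subprob_algebra borel"
proof (rule measurable_subprob_algebra)
  fix A :: "'e set" assume A: "A \<in> sets borel"
  have "(\<lambda>(s, x). measure (P s t x) A) \<in> borel_measurable (restrict_space borel ({0..T} \<times> UNIV))"
    using kernel t A unfolding transition_kernel_def by blast
  moreover have "Pair s \<in> borel \<rightarrow>\<^sub>M restrict_space borel ({0..T} \<times> (UNIV :: 'e set))"
    using s by (intro measurable_restrict_space2 borel_measurable_continuous_onI continuous_intros) auto
  ultimately have "(\<lambda>x. (\<lambda>(s, x). measure (P s t x) A) (s, x)) \<in> borel_measurable borel"
    by (rule measurable_compose[rotated])
  then have "(\<lambda>x. measure (P s t x) A) \<in> borel_measurable borel"
    by (simp only: prod.case)
  then have "(\<lambda>x. ennreal (measure (P s t x) A)) \<in> borel_measurable borel"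
    by measurable
  then show "(\<lambda>x. emeasure (P s t x) A) \<in> borel_measurable borel"
    using finite_measure.emeasure_eq_measure[OF prob_space.finite_measure[OF prob_space_kernel[OF s t]]]
    by simp
qed (use prob_space_kernel[OF s t] sets_kernel[OF s t] in \<open>auto intro: prob_space_imp_subprob_space\<close>)

lemma measurable_coord_PP:
  "s \<in> {0..T} \<Longrightarrow> t \<in> {0..T} \<Longrightarrow> (\<lambda>\<omega>. \<omega> t) \<in> \<PP> s x \<rightarrow>\<^sub>M borel"
  using measurable_coord_window_field[of t t T] window_field_le[of t t T]
    coord_field_mono[of "{t..T}" "{0..T}" T]
  by (auto simp: measurable_def sets_PP space_PP)

lemma marginal:
  assumes "s \<in> {0..T}" "t \<in> {0..T}"
  shows "distr (\<PP> s x) borel (\<lambda>\<omega>. \<omega> t) = P s t x"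
proof (rule measure_eqI)
  fix A :: "'e set" assume "A \<in> sets (distr (\<PP> s x) borel (\<lambda>\<omega>. \<omega> t))"
  then have A: "A \<in> sets borel" by simp
  interpret prob_space "\<PP> s x" using assms by (intro prob_space_PP)
  interpret K: prob_space "P s t x" using assms by (intro prob_space_kernel)
  have "emeasure (distr (\<PP> s x) borel (\<lambda>\<omega>. \<omega> t)) A = prob {\<omega> \<in> path_space T. \<omega> t \<in> A}"
    using A assms
    by (subst emeasure_distr) (auto simp: measurable_coord_PP space_PP emeasure_eq_measure
        intro!: arg_cong[where f = prob])
  also have "\<dots> = emeasure (P s t x) A"
    using markov assms A unfolding canonical_markov_class_def K.emeasure_eq_measure by simp
  finally show "emeasure (distr (\<PP> s x) borel (\<lambda>\<omega>. \<omega> t)) A = emeasure (P s t x) A" .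
qed (use assms in \<open>simp add: sets_kernel\<close>)

lemma AE_start:
  assumes s: "s \<in> {0..T}"
  shows "AE \<omega> in \<PP> s x. \<omega> s = x"
proof -
  interpret K: prob_space "P s s x" using s by (intro prob_space_kernel)
  have "measure (P s s x) {x} = indicator {x} x"
    using kernel s unfolding transition_kernel_def by (metis borel_singleton order_refl sets.empty_sets)
  then have "AE y in P s s x. y \<in> {x}"
    using s by (subst K.AE_in_set_eq_1) (auto simp: sets_kernel)
  then have "AE y in distr (\<PP> s x) borel (\<lambda>\<omega>. \<omega> s). y \<in> {x}"
    by (simp only: marginal[OF s s])
  then show ?thesis
    using s by (subst (asm) AE_distr_iff) (auto simp: measurable_coord_PP)
qed

text \<open>This is the conditional probability in the definition of a Markov class, integrated over an
  event \<open>H\<close> of the past.\<close>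

lemma markov_sets:
  assumes s: "s \<in> {0..T}" and t: "s \<le> t" "t \<le> u" "u \<le> T"
    and H: "H \<in> sets (past_field T t)" and A: "A \<in> sets borel"
  shows "emeasure (\<PP> s x) (H \<inter> {\<omega> \<in> path_space T. \<omega> u \<in> A})
      = (\<integral>\<^sup>+\<omega>. emeasure (P t u (\<omega> t)) A * indicator H \<omega> \<partial>\<PP> s x)"
proof -
  interpret prob_space "\<PP> s x" using s by (intro prob_space_PP)
  have tu: "t \<in> {0..T}" "u \<in> {0..T}" using s t by auto
  interpret finite_measure_subalgebra "\<PP> s x" "past_field T t"
    by standard (use s past_field_le[of T t] in \<open>simp add: subalgebra_def space_PP sets_PP\<close>)
  let ?U = "{\<omega> \<in> path_space T. \<omega> u \<in> A}" and ?f = "\<lambda>\<omega>. measure (P t u (\<omega> t)) A"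
  have [measurable]: "H \<in> events" using H subalg by (auto simp: subalgebra_def)
  have U [measurable]: "?U \<in> events"
    using cylinder_in_coord_field[of u "{0..T}" A T] s tu A by (simp add: sets_PP)
  have "(\<lambda>x. emeasure (P t u x) A) \<in> borel_measurable borel"
    using measurable_kernel[OF tu] A by (rule measurable_emeasure_kernel)
  then have "(\<lambda>\<omega>. emeasure (P t u (\<omega> t)) A) \<in> borel_measurable (\<PP> s x)"
    using measurable_coord_PP[OF s tu(1)] by (rule measurable_compose[rotated])
  then have f [measurable]: "?f \<in> borel_measurable (\<PP> s x)"
    unfolding measure_def by measurable
  have f_le: "?f \<omega> \<le> 1" for \<omega>
    using prob_space_kernel[OF tu] by (simp add: prob_space.prob_le_1)
  have "prob (H \<inter> ?U) = (\<integral>\<omega>\<in>H. indicator ?U \<omega> \<partial>\<PP> s x)"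
    by (simp add: set_lebesgue_integral_def indicator_inter_arith[symmetric])
  also have "\<dots> = (\<integral>\<omega>\<in>H. real_cond_exp (\<PP> s x) (past_field T t) (indicator ?U) \<omega> \<partial>\<PP> s x)"
    by (rule real_cond_exp_intA[OF _ H]) (simp add: less_top[symmetric])
  also have "\<dots> = (\<integral>\<omega>\<in>H. ?f \<omega> \<partial>\<PP> s x)"
  proof -
    have "AE \<omega> in \<PP> s x. real_cond_exp (\<PP> s x) (past_field T t) (indicator ?U) \<omega> = ?f \<omega>"
      using markov s t A unfolding canonical_markov_class_def by blast
    then show ?thesis
      unfolding set_lebesgue_integral_def by (intro integral_cong_AE) auto
  qed
  also have "\<dots> = (\<integral>\<omega>. ?f \<omega> * indicator H \<omega> \<partial>\<PP> s x)"
    by (simp add: set_lebesgue_integral_def mult.commute)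
  finally have "ennreal (prob (H \<inter> ?U)) = ennreal (\<integral>\<omega>. ?f \<omega> * indicator H \<omega> \<partial>\<PP> s x)"
    by simp
  also have "\<dots> = (\<integral>\<^sup>+\<omega>. ennreal (?f \<omega> * indicator H \<omega>) \<partial>\<PP> s x)"
    using f_le by (intro nn_integral_eq_integral[symmetric] integrable_const_bound[of _ 1])
      (auto simp: indicator_def)
  also have "\<dots> = (\<integral>\<^sup>+\<omega>. emeasure (P t u (\<omega> t)) A * indicator H \<omega> \<partial>\<PP> s x)"
    using finite_measure.emeasure_eq_measure[OF prob_space.finite_measure[OF prob_space_kernel[OF tu]]]
    by (intro nn_integral_cong) (simp add: indicator_def)
  finally show ?thesis by (simp add: emeasure_eq_measure)
qed

text \<open>For fixed \<open>H\<close> both sides are integrals of \<open>g\<close> with respect to measures on the state space, so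
  that it is enough to identify these two measures, on sets.\<close>

lemma markov_nn_integral:
  assumes s: "s \<in> {0..T}" and t: "s \<le> t" "t \<le> u" "u \<le> T"
    and H: "H \<in> sets (past_field T t)" and g [measurable]: "g \<in> borel_measurable borel"
  shows "(\<integral>\<^sup>+\<omega>. g (\<omega> u) * indicator H \<omega> \<partial>\<PP> s x)
      = (\<integral>\<^sup>+\<omega>. (\<integral>\<^sup>+y. g y \<partial>P t u (\<omega> t)) * indicator H \<omega> \<partial>\<PP> s x)"
proof -
  have tu: "t \<in> {0..T}" "u \<in> {0..T}" using s t by auto
  define N where "N = density (\<PP> s x) (indicator H)"
  have [simp]: "sets N = sets (\<PP> s x)" "space N = space (\<PP> s x)" by (simp_all add: N_def)
  have [measurable]: "H \<in> sets (\<PP> s x)" using H past_field_le[of T t] s by (auto simp: sets_PP)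
  note [measurable] = measurable_kernel[OF tu] measurable_coord_PP[OF s tu(1), of x]
    measurable_coord_PP[OF s tu(2), of x]
  have X: "(\<lambda>\<omega>. \<omega> t) \<in> N \<rightarrow>\<^sub>M borel" "(\<lambda>\<omega>. \<omega> u) \<in> N \<rightarrow>\<^sub>M borel"
    unfolding N_def by measurable
  note [measurable] = X
  have ne: "space (\<PP> s x) \<noteq> {}" using prob_space.not_empty[OF prob_space_PP[OF s]] .
  have int_N: "(\<integral>\<^sup>+\<omega>. h \<omega> \<partial>N) = (\<integral>\<^sup>+\<omega>. h \<omega> * indicator H \<omega> \<partial>\<PP> s x)"
    if [measurable]: "h \<in> borel_measurable (\<PP> s x)" for h
    unfolding N_def by (subst nn_integral_density) (auto simp: mult.commute)
  have eq: "distr N borel (\<lambda>\<omega>. \<omega> u) = distr N borel (\<lambda>\<omega>. \<omega> t) \<bind> P t u"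
  proof (rule measure_eqI)
    show "sets (distr N borel (\<lambda>\<omega>. \<omega> u)) = sets (distr N borel (\<lambda>\<omega>. \<omega> t) \<bind> P t u)"
      using ne by (subst sets_bind[where N = borel]) (auto simp only: sets_kernel[OF tu] sets_distr space_distr space_borel UNIV_not_empty)
    fix A assume "A \<in> sets (distr N borel (\<lambda>\<omega>. \<omega> u))"
    then have A [measurable]: "A \<in> sets borel" by simp
    have "emeasure (distr N borel (\<lambda>\<omega>. \<omega> u)) A = (\<integral>\<^sup>+\<omega>. indicator A (\<omega> u) \<partial>N)"
      using A by (subst nn_integral_distr[OF X(2), symmetric]) auto
    also have "\<dots> = (\<integral>\<^sup>+\<omega>. indicator (H \<inter> {\<omega> \<in> path_space T. \<omega> u \<in> A}) \<omega> \<partial>\<PP> s x)"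
      using s by (subst int_N) (auto intro!: nn_integral_cong simp: indicator_def space_PP)
    also have "\<dots> = emeasure (\<PP> s x) (H \<inter> {\<omega> \<in> path_space T. \<omega> u \<in> A})"
    proof (rule nn_integral_indicator, rule sets.Int)
      show "{\<omega> \<in> path_space T. \<omega> u \<in> A} \<in> sets (\<PP> s x)"
        using cylinder_in_coord_field[OF tu(2) A] by (simp add: sets_PP[OF s])
    qed measurable
    also have "\<dots> = (\<integral>\<^sup>+\<omega>. emeasure (P t u (\<omega> t)) A * indicator H \<omega> \<partial>\<PP> s x)"
      by (rule markov_sets[OF s t H A])
    also have "\<dots> = (\<integral>\<^sup>+\<omega>. emeasure (P t u (\<omega> t)) A \<partial>N)"
      by (rule int_N[symmetric]) measurable
    also have "\<dots> = emeasure (distr N borel (\<lambda>\<omega>. \<omega> t) \<bind> P t u) A"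
      using ne by (subst emeasure_bind[where N = borel]) (auto simp: nn_integral_distr)
    finally show "emeasure (distr N borel (\<lambda>\<omega>. \<omega> u)) A = emeasure (distr N borel (\<lambda>\<omega>. \<omega> t) \<bind> P t u) A" .
  qed
  have "(\<integral>\<^sup>+\<omega>. g (\<omega> u) * indicator H \<omega> \<partial>\<PP> s x) = (\<integral>\<^sup>+y. g y \<partial>distr N borel (\<lambda>\<omega>. \<omega> u))"
    by (subst nn_integral_distr) (auto simp: int_N)
  also have "\<dots> = (\<integral>\<^sup>+\<omega>. (\<integral>\<^sup>+y. g y \<partial>P t u (\<omega> t)) \<partial>N)"
    unfolding eq by (subst nn_integral_bind[where B = borel]) (auto simp: nn_integral_distr)
  also have "\<dots> = (\<integral>\<^sup>+\<omega>. (\<integral>\<^sup>+y. g y \<partial>P t u (\<omega> t)) * indicator H \<omega> \<partial>\<PP> s x)"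
    by (rule int_N) measurable
  finally show ?thesis .
qed

end

text \<open>A list may mention a time several times and in any order, so that intersecting two cylinders
  amounts to appending their lists.\<close>

definition cylinder :: "real \<Rightarrow> (real \<times> 'e::topological_space set) list \<Rightarrow> (real \<Rightarrow> 'e) set" where
  "cylinder T L = {\<omega> \<in> path_space T. \<forall>(r, B)\<in>set L. \<omega> r \<in> B}"

lemma cylinder_Cons: "cylinder T ((r, B) # L) = {\<omega> \<in> path_space T. \<omega> r \<in> B} \<inter> cylinder T L"
  by (auto simp: cylinder_def)

lemma cylinder_in_sets_coord_field:
  assumes "set L \<subseteq> I \<times> sets borel"
  shows "cylinder T L \<in> sets (coord_field T I)"
  using assms
proof (induction L)
  case Nil
  then show ?case using sets.top[of "coord_field T I"] by (simp add: cylinder_def)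
next
  case (Cons a L)
  then show ?case
    by (cases a) (auto simp: cylinder_Cons intro!: sets.Int cylinder_in_coord_field)
qed

lemma Int_stable_cylinders: "Int_stable (cylinder T ` {L. set L \<subseteq> C})"
proof (rule Int_stableI)
  fix A B assume "A \<in> cylinder T ` {L. set L \<subseteq> C}" "B \<in> cylinder T ` {L. set L \<subseteq> C}"
  then obtain L L' where "A = cylinder T L" "B = cylinder T L'" "set (L @ L') \<subseteq> C"
    by auto
  moreover have "cylinder T L \<inter> cylinder T L' = cylinder T (L @ L')"
    by (auto simp: cylinder_def)
  ultimately show "A \<inter> B \<in> cylinder T ` {L. set L \<subseteq> C}" by blast
qed

lemma coord_field_subset_sigma_cylinders:
  "sets (coord_field T I) \<subseteq> sigma_sets (path_space T) (cylinder T ` {L. set L \<subseteq> I \<times> sets borel})"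
  unfolding sets_coord_field
proof (rule sigma_sets_mono', rule subsetI)
  fix A assume "A \<in> {{\<omega> \<in> path_space T. \<omega> r \<in> B} |r B. r \<in> I \<and> B \<in> sets borel}"
  then obtain r B where A: "A = {\<omega> \<in> path_space T. \<omega> r \<in> B}" "r \<in> I" "B \<in> sets borel"
    by blast
  show "A \<in> cylinder T ` {L. set L \<subseteq> I \<times> sets borel}"
    by (rule image_eqI[of _ _ "[(r, B)]"]) (use A in \<open>auto simp: cylinder_def\<close>)
qed

context markov_class
begin

text \<open>The first claim, measurability of \<open>y \<mapsto> \<PP> s y (cylinder)\<close>, and the second one, the Markov
  property at \<open>s\<close>, have to be proved together, by induction on the number of times. If \<open>t\<close> is the
  first time, the induction hypothesis at \<open>t\<close> turns the remaining times into a measurable function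
  of \<open>X\<^sub>t\<close>, which the kernel \<open>P s t\<close> then turns into a measurable function \<open>g s\<close> of \<open>X\<^sub>s\<close>. Taking the
  law \<open>\<PP> s y\<close>, under which \<open>X\<^sub>s = y\<close> almost surely, identifies \<open>g s\<close> with the probability of the
  cylinder.\<close>

lemma markov_cylinder_sorted:
  assumes "sorted (map fst L)" "set L \<subseteq> {s..T} \<times> sets borel" "s \<in> {0..T}"
  shows "(\<lambda>y. emeasure (\<PP> s y) (cylinder T L)) \<in> borel_measurable borel"
    and "r \<in> {0..s} \<Longrightarrow> H \<in> sets (past_field T s) \<Longrightarrow> emeasure (\<PP> r x) (H \<inter> cylinder T L)
      = (\<integral>\<^sup>+\<omega>. emeasure (\<PP> s (\<omega> s)) (cylinder T L) * indicator H \<omega> \<partial>\<PP> r x)"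
  using assms
proof (induction L arbitrary: s r x H)
  case Nil
  {
    case 1
    then show ?case using prob_space.emeasure_space_1[OF prob_space_PP]
      by (simp add: cylinder_def space_PP)
  next
    case 2
    then have r: "r \<in> {0..T}" and H: "H \<in> sets (\<PP> r x)"
      using past_field_le[of T s] by (auto simp: sets_PP)
    then have "H \<subseteq> path_space T" using sets.sets_into_space[OF H] by (simp add: space_PP)
    moreover have "emeasure (\<PP> s y) (path_space T) = 1" for y
      using prob_space.emeasure_space_1[OF prob_space_PP[of s y]] 2 by (simp add: space_PP)
    ultimately show ?case using H by (simp add: cylinder_def Int_absorb2)
  }
next
  case (Cons a L)
  obtain t B where a: "a = (t, B)" by (cases a)
  define g where "g s = (\<lambda>y. (\<integral>\<^sup>+z. emeasure (\<PP> t z) (cylinder T L) * indicator B z \<partial>P s t y))" for s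
  \<comment> \<open>The event \<open>X\<^sub>t \<in> B\<close> belongs to the past of \<open>t\<close>, hence is absorbed by \<open>H\<close> when the induction
    hypothesis is applied at time \<open>t\<close>.\<close>
  have step: "emeasure (\<PP> r x) (H \<inter> cylinder T (a # L))
      = (\<integral>\<^sup>+\<omega>. g s (\<omega> s) * indicator H \<omega> \<partial>\<PP> r x)"
    and g_meas: "g s \<in> borel_measurable borel"
    if H: "H \<in> sets (past_field T s)" and r: "r \<in> {0..s}" and s: "s \<in> {0..T}"
      and L: "sorted (map fst (a # L))" "set (a # L) \<subseteq> {s..T} \<times> sets borel" for r x H s
  proof -
    have rT: "r \<in> {0..T}" and t: "s \<le> t" "t \<le> T" and B: "B \<in> sets borel"
      and L': "sorted (map fst L)" "set L \<subseteq> {t..T} \<times> sets borel" and tT: "t \<in> {0..T}"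
      using r s L order_trans[of 0 s t] by (auto simp: a subset_iff)
    have m [measurable]: "(\<lambda>y. emeasure (\<PP> t y) (cylinder T L)) \<in> borel_measurable borel"
      using L' tT by (rule Cons.IH)
    note [measurable] = B measurable_kernel[OF s tT]
    show "g s \<in> borel_measurable borel" unfolding g_def by measurable
    have H': "H \<inter> {\<omega> \<in> path_space T. \<omega> t \<in> B} \<in> sets (past_field T t)"
      using H past_field_mono[OF t(1), of T] cylinder_in_past_field[of t T B] tT B by auto
    have "emeasure (\<PP> r x) (H \<inter> cylinder T (a # L))
        = emeasure (\<PP> r x) ((H \<inter> {\<omega> \<in> path_space T. \<omega> t \<in> B}) \<inter> cylinder T L)"
      by (simp add: a cylinder_Cons Int_assoc)
    also have "\<dots> = (\<integral>\<^sup>+\<omega>. emeasure (\<PP> t (\<omega> t)) (cylinder T L)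
        * indicator (H \<inter> {\<omega> \<in> path_space T. \<omega> t \<in> B}) \<omega> \<partial>\<PP> r x)"
      using L' tT H' r t by (intro Cons.IH) auto
    also have "\<dots> = (\<integral>\<^sup>+\<omega>. (emeasure (\<PP> t (\<omega> t)) (cylinder T L) * indicator B (\<omega> t)) * indicator H \<omega> \<partial>\<PP> r x)"
      using rT by (intro nn_integral_cong) (auto simp: space_PP indicator_def)
    also have "\<dots> = (\<integral>\<^sup>+\<omega>. g s (\<omega> s) * indicator H \<omega> \<partial>\<PP> r x)"
      unfolding g_def using r t rT H by (intro markov_nn_integral) auto
    finally show "emeasure (\<PP> r x) (H \<inter> cylinder T (a # L)) = \<dots>" .
  qed
  have g: "emeasure (\<PP> s y) (cylinder T (a # L)) = g s y"
    if s: "s \<in> {0..T}" and L: "sorted (map fst (a # L))" "set (a # L) \<subseteq> {s..T} \<times> sets borel" for s y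
  proof -
    have top: "path_space T \<in> sets (past_field T s)" using sets.top[of "past_field T s"] by simp
    have "emeasure (\<PP> s y) (cylinder T (a # L)) = emeasure (\<PP> s y) (path_space T \<inter> cylinder T (a # L))"
      by (intro arg_cong[where f = "emeasure _"]) (auto simp: cylinder_def)
    also have "\<dots> = (\<integral>\<^sup>+\<omega>. g s (\<omega> s) * indicator (path_space T) \<omega> \<partial>\<PP> s y)"
      using s L by (intro step top) auto
    also have "\<dots> = (\<integral>\<^sup>+\<omega>. g s y \<partial>\<PP> s y)"
      using AE_start[OF s, of y] AE_space
      by (intro nn_integral_cong_AE, eventually_elim) (simp add: space_PP[OF s])
    also have "\<dots> = g s y"
      using prob_space.emeasure_space_1[OF prob_space_PP[OF s]] by simp
    finally show ?thesis .
  qed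
  {
    case 1
    have "(\<lambda>y. emeasure (\<PP> s y) (cylinder T (a # L))) = g s" using g 1 by auto
    moreover have "g s \<in> borel_measurable borel"
      using 1 by (intro g_meas[of "{}" s s]) auto
    ultimately show ?case by simp
  next
    case 2
    then show ?case by (subst step[OF 2(2,1)]) (simp_all add: g)
  }
qed

text \<open>Both claims pass from cylinders to all events of \<open>\<sigma>(X\<^sub>r | r \<ge> s)\<close> by a Dynkin argument.\<close>

lemma markov_coord_field:
  assumes s: "s \<in> {0..T}" and F: "F \<in> sets (coord_field T {s..T})"
  shows "(\<lambda>y. emeasure (\<PP> s y) F) \<in> borel_measurable borel \<and>
    (\<forall>r\<in>{0..s}. \<forall>x. emeasure (\<PP> r x) F = (\<integral>\<^sup>+y. emeasure (\<PP> s y) F \<partial>P r s x))"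
proof -
  define G where "G = cylinder T ` {L :: (real \<times> 'e set) list. set L \<subseteq> {s..T} \<times> sets borel}"
  have top: "emeasure (\<PP> r x) (path_space T) = 1" if "r \<in> {0..s}" for r x
    using prob_space.emeasure_space_1[OF prob_space_PP[of r x]] that s by (simp add: space_PP)
  have G_sets: "A \<in> sets (\<PP> r x)" if "A \<in> sigma_sets (path_space T) G" "r \<in> {0..s}" for A r x
  proof -
    have "G \<subseteq> sets (\<PP> r x)"
      unfolding G_def using that s
      by (auto intro!: sets_PP_if_coord_field[of r s] cylinder_in_sets_coord_field)
    then have "sigma_sets (space (\<PP> r x)) G \<subseteq> sets (\<PP> r x)" by (rule sets.sigma_sets_subset)
    then show ?thesis using that s by (auto simp: space_PP)
  qed
  have meas: "(\<lambda>y. f y) \<in> borel_measurable (P r s x)"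
    if "f \<in> borel_measurable borel" "r \<in> {0..s}" for f :: "'e \<Rightarrow> ennreal" and r x
    using that s sets_kernel[of r s x] by (simp cong: measurable_cong_sets)
  have one: "emeasure (P r s x) (space (P r s x)) = 1" if "r \<in> {0..s}" for r x
    using prob_space.emeasure_space_1[OF prob_space_kernel[of r s x]] that s by simp
  have "Int_stable G" "G \<subseteq> Pow (path_space T)"
    using Int_stable_cylinders by (auto simp: G_def cylinder_def)
  moreover have "F \<in> sigma_sets (path_space T) G"
    using F coord_field_subset_sigma_cylinders unfolding G_def by blast
  ultimately show ?thesis
  proof (induction rule: sigma_sets_induct_disjoint)
    case (basic A)
    then obtain L where L: "A = cylinder T L" "set L \<subseteq> {s..T} \<times> sets borel"
      unfolding G_def by blast
    define K where "K = sort_key fst L"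
    have K: "A = cylinder T K" "set K \<subseteq> {s..T} \<times> sets borel" "sorted (map fst K)"
      using L by (simp_all add: K_def cylinder_def)
    note cyl = markov_cylinder_sorted[OF K(3,2) s]
    have "emeasure (\<PP> r x) A = (\<integral>\<^sup>+y. emeasure (\<PP> s y) A \<partial>P r s x)" if r: "r \<in> {0..s}" for r x
    proof -
      have rT: "r \<in> {0..T}" using r s by auto
      have "emeasure (\<PP> r x) A = emeasure (\<PP> r x) (path_space T \<inter> cylinder T K)"
        unfolding K(1) by (intro arg_cong[where f = "emeasure _"]) (auto simp: cylinder_def)
      also have "\<dots> = (\<integral>\<^sup>+\<omega>. emeasure (\<PP> s (\<omega> s)) A * indicator (path_space T) \<omega> \<partial>\<PP> r x)"
        unfolding K(1) using r sets.top[of "past_field T s"] by (intro cyl(2)) auto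
      also have "\<dots> = (\<integral>\<^sup>+\<omega>. emeasure (\<PP> s (\<omega> s)) A \<partial>\<PP> r x)"
        using rT by (intro nn_integral_cong) (simp add: space_PP)
      also have "\<dots> = (\<integral>\<^sup>+y. emeasure (\<PP> s y) A \<partial>distr (\<PP> r x) borel (\<lambda>\<omega>. \<omega> s))"
        using cyl(1) measurable_coord_PP[OF rT s] unfolding K(1) by (simp add: nn_integral_distr)
      finally show ?thesis using marginal[OF rT s] by simp
    qed
    then show ?case using cyl(1) K(1) by blast
  next
    case empty
    then show ?case by simp
  next
    case (compl A)
    have c: "emeasure (\<PP> r x) (path_space T - A) = 1 - emeasure (\<PP> r x) A" if "r \<in> {0..s}" for r x
    proof -
      interpret prob_space "\<PP> r x" using that s by (intro prob_space_PP) auto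
      show ?thesis
        using emeasure_compl[OF G_sets[OF compl(1) that]] that s top[OF that]
        by (simp add: space_PP)
    qed
    have [measurable]: "(\<lambda>y. emeasure (\<PP> s y) A) \<in> borel_measurable borel" using compl by blast
    have "emeasure (\<PP> r x) (path_space T - A) = (\<integral>\<^sup>+y. emeasure (\<PP> s y) (path_space T - A) \<partial>P r s x)"
      if r: "r \<in> {0..s}" for r x
    proof -
      have A: "emeasure (\<PP> r x) A = (\<integral>\<^sup>+y. emeasure (\<PP> s y) A \<partial>P r s x)" using compl r by blast
      have "A \<subseteq> path_space T" using sets.sets_into_space[OF G_sets[OF compl(1) r]] r s by (simp add: space_PP)
      then have le: "emeasure (\<PP> r x) A \<le> 1" if "r \<in> {0..s}" for r x
        using emeasure_space[of "\<PP> r x" A] top[OF that, of x] that s by (simp add: space_PP)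
      have "(\<integral>\<^sup>+y. 1 - emeasure (\<PP> s y) A \<partial>P r s x) = 1 - (\<integral>\<^sup>+y. emeasure (\<PP> s y) A \<partial>P r s x)"
        using le[OF r, of x] le[of s] s r
        by (subst nn_integral_diff) (auto simp: one meas A[symmetric] top_unique)
      then show ?thesis using s r by (simp add: c A)
    qed
    moreover have "(\<lambda>y. emeasure (\<PP> s y) (path_space T - A)) \<in> borel_measurable borel"
      using s by (simp add: c)
    ultimately show ?case by blast
  next
    case (union A)
    have c: "emeasure (\<PP> r x) (\<Union>i. A i) = (\<Sum>i. emeasure (\<PP> r x) (A i))" if "r \<in> {0..s}" for r x
      using union G_sets that by (intro suminf_emeasure[symmetric]) auto
    have [measurable]: "(\<lambda>y. emeasure (\<PP> s y) (A i)) \<in> borel_measurable borel" for i using union by blast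
    have "emeasure (\<PP> r x) (\<Union>i. A i) = (\<integral>\<^sup>+y. emeasure (\<PP> s y) (\<Union>i. A i) \<partial>P r s x)"
      if r: "r \<in> {0..s}" for r x
    proof -
      have "emeasure (\<PP> r x) (A i) = (\<integral>\<^sup>+y. emeasure (\<PP> s y) (A i) \<partial>P r s x)" for i
        using union r by blast
      then show ?thesis using s r by (simp add: c nn_integral_suminf meas)
    qed
    moreover have "(\<lambda>y. emeasure (\<PP> s y) (\<Union>i. A i)) \<in> borel_measurable borel"
      using s by (simp add: c)
    ultimately show ?case by blast
  qed
qed

end


section \<open>A limit in probability common to all laws\<close>

text \<open>The hypothesis only concerns the laws \<open>\<PP> t y\<close> that start at time \<open>t\<close>, and lets the limit depend
  on \<open>y\<close>. As \<open>X\<^sub>t = y\<close> under \<open>\<PP> t y\<close>, a limit that depends on \<open>y\<close> is a limit that depends on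
  \<open>X\<^sub>t\<close>; the difficulty is to choose it measurably, and \<open>r k\<close> below serves to do that. A law that starts
  earlier is a mixture of the laws \<open>\<PP> t y\<close> on the events posterior to \<open>t\<close>, and convergence in
  probability is inherited by mixtures.\<close>

lemma (in markov_class) common_limit_in_prob:
  assumes t: "t \<in> {0..T}"
    and G: "space G = path_space T" "sets G \<subseteq> sets (coord_field T {t..T})"
    and X [measurable]: "(\<lambda>\<omega>. \<omega> t) \<in> G \<rightarrow>\<^sub>M borel"
    and S [measurable]: "\<And>n. S n \<in> borel_measurable G"
    and conv: "\<And>y. \<exists>Q \<in> borel_measurable (completion (\<PP> t y)).
      tends_in_prob (completion (\<PP> t y)) S Q"
  shows "\<exists>Z \<in> borel_measurable G. \<forall>s\<in>{0..t}. \<forall>x. tends_in_prob (\<PP> s x) S Z"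
proof -
  define p where "p k m n y = measure (\<PP> t y) {\<omega> \<in> path_space T. \<bar>S m \<omega> - S n \<omega>\<bar> > (1/2) ^ k}"
    for k m n y
  define r where "r k y = (LEAST n. \<forall>m\<ge>n. p k m n y \<le> (1/2) ^ k)" for k y
  \<comment> \<open>Where the sequence diverges, \<open>lim\<close> has an unspecified but constant value, which keeps \<open>Z\<close>
    measurable.\<close>
  define Z where "Z \<omega> = lim (\<lambda>k. S (r k (\<omega> t)) \<omega>)" for \<omega>
  have PP_meas: "(\<lambda>y. measure (\<PP> t y) F) \<in> borel_measurable borel" if "F \<in> sets G" for F
  proof -
    have [measurable]: "(\<lambda>y. emeasure (\<PP> t y) F) \<in> borel_measurable borel"
      using markov_coord_field[OF t, of F] that G(2) by auto
    show ?thesis unfolding measure_def by measurable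
  qed
  have Z: "Z \<in> borel_measurable G"
  proof -
    have "{\<omega> \<in> path_space T. \<bar>S m \<omega> - S n \<omega>\<bar> > (1/2) ^ k} \<in> sets G" for k m n
      unfolding G(1)[symmetric] by measurable
    then have [measurable]: "p k m n \<in> borel_measurable borel" for k m n
      unfolding p_def by (rule PP_meas)
    have [measurable]: "r k \<in> borel \<rightarrow>\<^sub>M count_space UNIV" for k
      unfolding r_def by measurable
    have [measurable]: "(\<lambda>\<omega>. S (r k (\<omega> t)) \<omega>) \<in> borel_measurable G" for k
      by (rule measurable_compose_countable[of "\<lambda>n \<omega>. S n \<omega>"]) measurable
    show ?thesis unfolding Z_def by measurable
  qed
  have measurable_PP: "f \<in> borel_measurable (\<PP> s x)" if "f \<in> borel_measurable G" "s \<in> {0..t}" for f :: "_ \<Rightarrow> real" and s x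
  proof (rule measurableI)
    fix A :: "real set" assume "A \<in> sets borel"
    then have "f -` A \<inter> path_space T \<in> sets (coord_field T {t..T})"
      using measurable_sets[OF that(1), of A] G by (metis subsetD)
    moreover have "s \<in> {0..T}" "0 \<le> t" using that(2) t by auto
    ultimately have "f -` A \<inter> path_space T \<in> sets (\<PP> s x)" by (intro sets_PP_if_coord_field)
    then show "f -` A \<inter> space (\<PP> s x) \<in> sets (\<PP> s x)"
      using space_PP[OF \<open>s \<in> {0..T}\<close>] by simp
  qed simp
  have at_t: "tends_in_prob (\<PP> t y) S Z" for y
  proof -
    interpret prob_space "\<PP> t y" using t by (rule prob_space_PP)
    interpret C: prob_space "completion (\<PP> t y)" by (rule prob_space_completion)
    have m [measurable]: "S n \<in> borel_measurable (\<PP> t y)" "Z \<in> borel_measurable (\<PP> t y)" for n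
      using measurable_PP[OF S] measurable_PP[OF Z] t by simp_all
    then have mC: "S n \<in> borel_measurable (completion (\<PP> t y))" "Z \<in> borel_measurable (completion (\<PP> t y))" for n
      by (auto intro: measurable_completion)
    obtain Q where Q: "Q \<in> borel_measurable (completion (\<PP> t y))"
      and lim: "tends_in_prob (completion (\<PP> t y)) S Q"
      using conv[of y] by blast
    have p: "C.prob {\<omega> \<in> space (completion (\<PP> t y)). \<bar>S m \<omega> - S n \<omega>\<bar> > (1/2) ^ k} = p k m n y" for k m n
    proof -
      have "{\<omega> \<in> space (\<PP> t y). \<bar>S m \<omega> - S n \<omega>\<bar> > (1/2) ^ k} \<in> sets (\<PP> t y)" by measurable
      from measure_completion[OF this] show ?thesis by (simp add: p_def space_PP[OF t])
    qed
    have "\<exists>n. \<forall>m\<ge>n. p k m n y \<le> (1/2) ^ k" for k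
      using C.tends_in_prob_Cauchy[OF mC(1) Q lim, of "(1/2) ^ k"] unfolding p by simp
    then have "p k m (r k y) y \<le> (1/2) ^ k" if "m \<ge> r k y" for k m
      using LeastI_ex[of "\<lambda>n. \<forall>m\<ge>n. p k m n y \<le> (1/2) ^ k"] that unfolding r_def by blast
    then have "AE \<omega> in completion (\<PP> t y). (\<lambda>k. S (r k y) \<omega>) \<longlonglongrightarrow> Q \<omega>"
      by (intro C.tends_in_prob_fast_subseq[OF mC(1) Q lim]) (simp only: p)
    moreover have "AE \<omega> in completion (\<PP> t y). \<omega> t = y"
      using AE_completion[OF AE_start[OF t]] .
    ultimately have "AE \<omega> in completion (\<PP> t y). Q \<omega> = Z \<omega>"
      by eventually_elim (simp add: Z_def limI)
    then have "tends_in_prob (completion (\<PP> t y)) S Z"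
      by (rule C.tends_in_prob_AE_cong[OF mC(1) mC(1) Q mC(2) AE_I2[OF refl] _ lim])
    then show ?thesis by (simp add: tends_in_prob_completion_iff m)
  qed
  have "tends_in_prob (\<PP> s x) S Z" if s: "s \<in> {0..t}" for s x
    unfolding tends_in_prob_def
  proof (intro allI impI)
    fix e :: real assume "e > 0"
    have sT: "s \<in> {0..T}" using s t by auto
    interpret prob_space "\<PP> s x" using sT by (rule prob_space_PP)
    interpret K: prob_space "P s t x" using sT t by (rule prob_space_kernel)
    define F where "F n = {\<omega> \<in> path_space T. \<bar>S n \<omega> - Z \<omega>\<bar> > e}" for n
    have F: "F n \<in> sets G" for n
      unfolding F_def G(1)[symmetric] using Z by measurable
    have m [measurable]: "(\<lambda>y. measure (\<PP> t y) (F n)) \<in> borel_measurable (P s t x)" for n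
      using PP_meas[OF F, of n] sets_kernel[OF sT t, of x] by (simp cong: measurable_cong_sets)
    have "prob (F n) = (\<integral>y. measure (\<PP> t y) (F n) \<partial>P s t x)" for n
    proof -
      have "emeasure (\<PP> s x) (F n) = (\<integral>\<^sup>+y. emeasure (\<PP> t y) (F n) \<partial>P s t x)"
        using markov_coord_field[OF t, of "F n"] F[of n] G(2) s by blast
      also have "\<dots> = (\<integral>\<^sup>+y. ennreal (measure (\<PP> t y) (F n)) \<partial>P s t x)"
        using finite_measure.emeasure_eq_measure[OF prob_space.finite_measure[OF prob_space_PP[OF t]]]
        by simp
      finally show ?thesis
        using integral_eq_nn_integral[OF m, of n] by (simp add: measure_def[of "\<PP> s x"])
    qed
    moreover have "(\<lambda>n. \<integral>y. measure (\<PP> t y) (F n) \<partial>P s t x) \<longlonglongrightarrow> (\<integral>y. 0 \<partial>P s t x)"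
    proof (rule integral_dominated_convergence[where w = "\<lambda>_. 1"])
      show "AE y in P s t x. (\<lambda>n. measure (\<PP> t y) (F n)) \<longlonglongrightarrow> 0"
        using at_t \<open>e > 0\<close> t unfolding tends_in_prob_def F_def by (simp add: space_PP)
      show "AE y in P s t x. norm (measure (\<PP> t y) (F n)) \<le> 1" for n
        using prob_space.prob_le_1[OF prob_space_PP[OF t]] by simp
    qed auto
    ultimately show "(\<lambda>n. prob {\<omega> \<in> space (\<PP> s x). \<bar>S n \<omega> - Z \<omega>\<bar> > e}) \<longlonglongrightarrow> 0"
      using sT by (simp add: space_PP F_def)
  qed
  then show ?thesis using Z by blast
qed


section \<open>Subdivisions\<close>

text \<open>The points of a subdivision increase strictly, so that an interval reduced to a point has to be
  subdivided into no step at all.\<close>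

definition uniform_size :: "real \<Rightarrow> real \<Rightarrow> nat \<Rightarrow> nat" where
  "uniform_size a b n = (if a = b then 0 else Suc n)"

definition uniform_point :: "real \<Rightarrow> real \<Rightarrow> nat \<Rightarrow> nat \<Rightarrow> real" where
  "uniform_point a b n i = a + real i * ((b - a) / real (Suc n))"

lemma vanishing_uniform:
  assumes "a \<le> b"
  shows "vanishing_subdivisions a b (uniform_size a b) (uniform_point a b)"
proof (cases "a = b")
  case False
  have step: "uniform_point a b n (Suc i) - uniform_point a b n i = (b - a) / real (Suc n)" for n i
    by (simp add: uniform_point_def field_simps del: of_nat_Suc) (simp add: field_simps)
  have "(\<lambda>n. (b - a) * inverse (real (Suc n))) \<longlonglongrightarrow> 0"
    using LIMSEQ_inverse_real_of_nat by (rule tendsto_mult_right_zero)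
  then have *: "\<forall>\<^sub>F n in sequentially. (b - a) * inverse (real (Suc n)) < \<delta>" if "\<delta> > 0" for \<delta>
    using that by (rule order_tendstoD)
  have "\<forall>\<^sub>F n in sequentially. \<forall>i<uniform_size a b n. (b - a) / real (Suc n) < \<delta>" if "\<delta> > 0" for \<delta>
    using eventually_mono[OF *[OF that]] by (simp add: divide_inverse del: of_nat_Suc)
  moreover have "uniform_point a b n i < uniform_point a b n (Suc i)" for n i
  proof -
    have "0 < (b - a) / real (Suc n)" using assms False by simp
    then show ?thesis using step[of n i] by linarith
  qed
  ultimately show ?thesis
    using False unfolding vanishing_subdivisions_def step
    by (simp add: uniform_size_def uniform_point_def del: of_nat_Suc)
qed (simp add: vanishing_subdivisions_def uniform_size_def uniform_point_def)

lemma vanishing_subdivisions_mono: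
  assumes "vanishing_subdivisions a b k \<tau>" "j \<le> k n" "i \<le> j"
  shows "\<tau> n i \<le> \<tau> n j"
  using assms(3,2)
proof (induction rule: dec_induct)
  case (step m)
  then have "\<tau> n m < \<tau> n (Suc m)" using assms(1) by (simp add: vanishing_subdivisions_def)
  then show ?case using step by simp
qed simp

lemma vanishing_subdivisions_in_interval:
  assumes "vanishing_subdivisions a b k \<tau>" "i \<le> k n"
  shows "a \<le> \<tau> n i" "\<tau> n i \<le> b"
  using vanishing_subdivisions_mono[OF assms(1), of i n 0]
    vanishing_subdivisions_mono[OF assms(1), of "k n" n i] assms
  by (auto simp: vanishing_subdivisions_def)

definition concat_subdivision ::
  "(nat \<Rightarrow> nat) \<Rightarrow> (nat \<Rightarrow> nat \<Rightarrow> real) \<Rightarrow> (nat \<Rightarrow> nat \<Rightarrow> real) \<Rightarrow> nat \<Rightarrow> nat \<Rightarrow> real" where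
  "concat_subdivision k \<sigma> \<tau> n i = (if i < k n then \<sigma> n i else \<tau> n (i - k n))"

lemma vanishing_subdivisions_concat:
  assumes \<sigma>: "vanishing_subdivisions a b k \<sigma>" and \<tau>: "vanishing_subdivisions b c l \<tau>"
  shows "vanishing_subdivisions a c (\<lambda>n. k n + l n) (concat_subdivision k \<sigma> \<tau>)"
proof -
  let ?\<rho> = "concat_subdivision k \<sigma> \<tau>"
  have ends: "\<sigma> n 0 = a" "\<sigma> n (k n) = b" "\<tau> n 0 = b" "\<tau> n (l n) = c" for n
    using \<sigma> \<tau> by (auto simp: vanishing_subdivisions_def)
  have 1: "?\<rho> n i = \<sigma> n i" if "i \<le> k n" for n i
    using that ends[of n] by (cases "i = k n") (auto simp: concat_subdivision_def)
  have 2: "?\<rho> n (k n + i) = \<tau> n i" for n i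
    by (simp add: concat_subdivision_def)
  have split: "(\<forall>i<k n + l n. R (?\<rho> n i) (?\<rho> n (Suc i))) \<longleftrightarrow>
      (\<forall>i<k n. R (\<sigma> n i) (\<sigma> n (Suc i))) \<and> (\<forall>i<l n. R (\<tau> n i) (\<tau> n (Suc i)))" for n R
  proof -
    have "(\<forall>i<k n + l n. Q i) \<longleftrightarrow> (\<forall>i<k n. Q i) \<and> (\<forall>i<l n. Q (k n + i))" for Q
      by (metis add_less_cancel_left le_add_diff_inverse not_less trans_less_add1)
    then show ?thesis using 2[of n "Suc _"] by (auto simp: 1 2 Suc_leI)
  qed
  have "\<forall>\<^sub>F n in sequentially. \<forall>i<k n + l n. ?\<rho> n (Suc i) - ?\<rho> n i < \<delta>" if "\<delta> > 0" for \<delta>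
  proof -
    have "\<forall>\<^sub>F n in sequentially. \<forall>i<k n. \<sigma> n (Suc i) - \<sigma> n i < \<delta>"
      "\<forall>\<^sub>F n in sequentially. \<forall>i<l n. \<tau> n (Suc i) - \<tau> n i < \<delta>"
      using \<sigma> \<tau> that unfolding vanishing_subdivisions_def by blast+
    then show ?thesis
      by eventually_elim (simp add: split[where R = "\<lambda>x y. y - x < \<delta>"])
  qed
  moreover have "\<forall>i<k n + l n. ?\<rho> n i < ?\<rho> n (Suc i)" for n
    using \<sigma> \<tau> unfolding split vanishing_subdivisions_def by blast
  moreover have "?\<rho> n 0 = a" "?\<rho> n (k n + l n) = c" for n
    by (simp_all only: 1[of 0] 2 ends le0)
  ultimately show ?thesis unfolding vanishing_subdivisions_def by blast
qed

lemma sum_concat_subdivision: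
  fixes f :: "real \<Rightarrow> real \<Rightarrow> 'a::comm_monoid_add"
  assumes "\<sigma> n (k n) = \<tau> n 0"
  shows "(\<Sum>i<k n + m. f (concat_subdivision k \<sigma> \<tau> n i) (concat_subdivision k \<sigma> \<tau> n (Suc i)))
    = (\<Sum>i<k n. f (\<sigma> n i) (\<sigma> n (Suc i))) + (\<Sum>i<m. f (\<tau> n i) (\<tau> n (Suc i)))"
proof (induction m)
  case 0
  have "concat_subdivision k \<sigma> \<tau> n i = \<sigma> n i" if "i \<le> k n" for i
    using that assms by (cases "i = k n") (auto simp: concat_subdivision_def)
  then show ?case by (simp add: Suc_leI)
next
  case (Suc m)
  have "concat_subdivision k \<sigma> \<tau> n (k n + m) = \<tau> n m"
    "concat_subdivision k \<sigma> \<tau> n (Suc (k n + m)) = \<tau> n (Suc m)"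
    by (simp_all add: concat_subdivision_def Suc_diff_le)
  then show ?case using Suc by (simp add: add.assoc)
qed


section \<open>Quadratic variation\<close>

context prob_space
begin

text \<open>Quadratic variation is characterised by subdivisions of \<open>[0,t]\<close> only. A subdivision of \<open>[t,u]\<close>
  is the difference between a subdivision of \<open>[0,u]\<close> through \<open>t\<close> and its part before \<open>t\<close>.\<close>

lemma quadratic_variation_increment:
  assumes QV: "is_quadratic_variation T M F Y Q"
    and t: "0 \<le> t" "t \<le> u" "u \<le> T"
    and Y: "\<And>r. r \<in> {0..T} \<Longrightarrow> Y r \<in> borel_measurable M"
    and Q: "\<And>r. r \<in> {0..T} \<Longrightarrow> Q r \<in> borel_measurable M"
    and \<tau>: "vanishing_subdivisions t u l \<tau>"
  shows "tends_in_prob M (\<lambda>n \<omega>. \<Sum>i<l n. (Y (\<tau> n (Suc i)) \<omega> - Y (\<tau> n i) \<omega>)\<^sup>2) (\<lambda>\<omega>. Q u \<omega> - Q t \<omega>)"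
proof -
  define k \<sigma> where "k = uniform_size 0 t" and "\<sigma> = uniform_point 0 t"
  let ?\<rho> = "concat_subdivision k \<sigma> \<tau>"
  have \<sigma>: "vanishing_subdivisions 0 t k \<sigma>"
    unfolding k_def \<sigma>_def using t by (intro vanishing_uniform) simp
  have \<rho>: "vanishing_subdivisions 0 u (\<lambda>n. k n + l n) ?\<rho>"
    using \<sigma> \<tau> by (rule vanishing_subdivisions_concat)
  have lim: "tends_in_prob M (\<lambda>n \<omega>. \<Sum>i<k n. (Y (\<sigma> n (Suc i)) \<omega> - Y (\<sigma> n i) \<omega>)\<^sup>2) (Q t)"
    "tends_in_prob M (\<lambda>n \<omega>. \<Sum>i<k n + l n. (Y (?\<rho> n (Suc i)) \<omega> - Y (?\<rho> n i) \<omega>)\<^sup>2) (Q u)"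
    using QV \<sigma> \<rho> t unfolding is_quadratic_variation_def by force+
  have meas: "(\<lambda>\<omega>. \<Sum>i<m n. (Y (\<pi> n (Suc i)) \<omega> - Y (\<pi> n i) \<omega>)\<^sup>2) \<in> borel_measurable M"
    if \<pi>: "vanishing_subdivisions 0 v m \<pi>" and v: "v \<le> T" for v m \<pi> n
  proof (rule borel_measurable_sum)
    fix i assume "i \<in> {..<m n}"
    then have [measurable]: "Y (\<pi> n (Suc i)) \<in> borel_measurable M" "Y (\<pi> n i) \<in> borel_measurable M"
      using vanishing_subdivisions_in_interval[OF \<pi>, of i n]
        vanishing_subdivisions_in_interval[OF \<pi>, of "Suc i" n] v by (auto intro!: Y)
    show "(\<lambda>\<omega>. (Y (\<pi> n (Suc i)) \<omega> - Y (\<pi> n i) \<omega>)\<^sup>2) \<in> borel_measurable M" by measurable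
  qed
  have "\<sigma> n (k n) = \<tau> n 0" for n
    using \<sigma> \<tau> by (simp add: vanishing_subdivisions_def)
  then have split: "(\<Sum>i<k n + l n. (Y (?\<rho> n (Suc i)) \<omega> - Y (?\<rho> n i) \<omega>)\<^sup>2)
      = (\<Sum>i<k n. (Y (\<sigma> n (Suc i)) \<omega> - Y (\<sigma> n i) \<omega>)\<^sup>2)
       + (\<Sum>i<l n. (Y (\<tau> n (Suc i)) \<omega> - Y (\<tau> n i) \<omega>)\<^sup>2)" for n \<omega>
    by (rule sum_concat_subdivision)
  have "tends_in_prob M
      (\<lambda>n \<omega>. (\<Sum>i<k n + l n. (Y (?\<rho> n (Suc i)) \<omega> - Y (?\<rho> n i) \<omega>)\<^sup>2)
        - (\<Sum>i<k n. (Y (\<sigma> n (Suc i)) \<omega> - Y (\<sigma> n i) \<omega>)\<^sup>2)) (\<lambda>\<omega>. Q u \<omega> - Q t \<omega>)"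
    using t by (intro tends_in_prob_diff lim meas[OF \<rho>] meas[OF \<sigma>] Q) auto
  then show ?thesis unfolding split by simp
qed

text \<open>At a fixed time up to \<open>s\<close> the sums of squares vanish, and so does their limit. Right continuity
  gives one null set for all times; it gives no information at \<open>s\<close> itself from the times before
  \<open>s\<close>, which is why \<open>s\<close> is added to the rational times.\<close>

lemma quadratic_variation_eq_0:
  assumes QV: "is_quadratic_variation T M F Y Q"
    and s: "s \<in> {0..T}"
    and Y: "\<And>r. r \<in> {0..T} \<Longrightarrow> Y r \<in> borel_measurable M"
    and Q: "\<And>r. r \<in> {0..T} \<Longrightarrow> Q r \<in> borel_measurable M"
    and null: "AE \<omega> in M. \<forall>u\<in>{0..s}. Y u \<omega> = 0"
  shows "AE \<omega> in M. \<forall>u\<in>{0..s}. Q u \<omega> = 0"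
proof -
  have Q0: "AE \<omega> in M. Q u \<omega> = 0" if u: "u \<in> {0..s}" for u
  proof -
    define k \<tau> where "k = uniform_size 0 u" and "\<tau> = uniform_point 0 u"
    have \<tau>: "vanishing_subdivisions 0 u k \<tau>"
      unfolding k_def \<tau>_def using u by (intro vanishing_uniform) simp
    have in_s: "\<tau> n i \<in> {0..s}" if "i \<le> k n" for n i
      using vanishing_subdivisions_in_interval[OF \<tau> that] u by auto
    let ?S = "\<lambda>n \<omega>. \<Sum>i<k n. (Y (\<tau> n (Suc i)) \<omega> - Y (\<tau> n i) \<omega>)\<^sup>2"
    have lim: "tends_in_prob M ?S (Q u)"
      using QV \<tau> u s unfolding is_quadratic_variation_def by force
    have S_meas: "?S n \<in> borel_measurable M" for n
    proof (rule borel_measurable_sum)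
      fix i assume "i \<in> {..<k n}"
      then have [measurable]: "Y (\<tau> n (Suc i)) \<in> borel_measurable M" "Y (\<tau> n i) \<in> borel_measurable M"
        using in_s[of i n] in_s[of "Suc i" n] s by (auto intro!: Y)
      show "(\<lambda>\<omega>. (Y (\<tau> n (Suc i)) \<omega> - Y (\<tau> n i) \<omega>)\<^sup>2) \<in> borel_measurable M" by measurable
    qed
    have "AE \<omega> in M. ?S n \<omega> = 0" for n
      using null
    proof eventually_elim
      case (elim \<omega>)
      then show ?case using in_s[of _ n] by (intro sum.neutral) (simp add: Suc_leI)
    qed
    then have "tends_in_prob M (\<lambda>n \<omega>. 0) (Q u)"
      using u s by (intro tends_in_prob_AE_cong[OF S_meas _ _ _ _ _ lim] Q) auto
    then show ?thesis
      using u s by (intro tends_in_prob_unique[where S = "\<lambda>n \<omega>. 0"] Q) (auto simp: tends_in_prob_def)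
  qed
  define D where "D = insert s ({0..s} \<inter> \<rat>)"
  have "countable D" unfolding D_def by (simp add: countable_rat)
  moreover have "AE \<omega> in M. Q u \<omega> = 0" if "u \<in> D" for u
    using that s by (intro Q0) (auto simp: D_def)
  ultimately have "AE \<omega> in M. \<forall>u\<in>D. Q u \<omega> = 0"
    by (simp add: AE_ball_countable)
  then show ?thesis using AE_space
  proof eventually_elim
    case (elim \<omega>)
    have rc: "((\<lambda>u. Q u \<omega>) \<longlongrightarrow> Q u \<omega>) (at_right u)" if "u \<in> {0..<T}" for u
      using QV elim(2) that
      unfolding is_quadratic_variation_def adapted_cadlag_def right_cont_left_lim_def by blast
    show ?case
    proof (intro ballI, rule ccontr)
      fix u assume u: "u \<in> {0..s}" and ne: "Q u \<omega> \<noteq> 0"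
      then have "u < s" using elim(1) by (cases "u = s") (auto simp: D_def)
      then have "\<forall>\<^sub>F v in at_right u. Q v \<omega> \<noteq> 0"
        using rc[of u] u s ne by (intro tendsto_imp_eventually_ne) auto
      then obtain b where b: "b > u" "\<And>v. u < v \<Longrightarrow> v < b \<Longrightarrow> Q v \<omega> \<noteq> 0"
        unfolding eventually_at_right_field by blast
      obtain q where "q \<in> \<rat>" "u < q" "q < min b s"
        using Rats_dense_in_real[of u "min b s"] b(1) \<open>u < s\<close> by auto
      then show False using b(2)[of q] elim(1) u by (auto simp: D_def)
    qed
  qed
qed

end


section \<open>The quadratic variation as an additive functional\<close>

context markov_class
begin

lemma augmented_field_le_completion:
  assumes "s \<in> {0..T}"
  shows "sets (augmented_field T (\<PP> s x) t) \<subseteq> sets (completion (\<PP> s x))"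
    and "space (augmented_field T (\<PP> s x) t) = path_space T"
proof -
  have "sets (past_field T t) \<union> null_sets (completion (\<PP> s x)) \<subseteq> sets (completion (\<PP> s x))"
    using past_field_le[of T t] sets_PP[OF assms, of x] by auto
  then have "sigma_sets (space (completion (\<PP> s x))) (sets (past_field T t) \<union> null_sets (completion (\<PP> s x)))
      \<subseteq> sets (completion (\<PP> s x))"
    by (rule sets.sigma_sets_subset)
  moreover have "sets (past_field T t) \<union> null_sets (completion (\<PP> s x)) \<subseteq> Pow (path_space T)"
    using sets.space_closed[of "past_field T t"] sets.space_closed[of "completion (\<PP> s x)"]
    by (auto simp: space_PP[OF assms])
  ultimately show "sets (augmented_field T (\<PP> s x) t) \<subseteq> sets (completion (\<PP> s x))"
    by (simp add: augmented_field_def space_PP[OF assms])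
qed (simp add: augmented_field_def space_measure_of_conv)

lemma adapted_measurable_completion:
  assumes "adapted_cadlag T (completion (\<PP> s x)) (augmented_field T (\<PP> s x)) Y"
    and s: "s \<in> {0..T}" and r: "r \<in> {0..T}"
  shows "Y r \<in> borel_measurable (completion (\<PP> s x))"
proof (rule measurableI)
  fix A :: "real set" assume "A \<in> sets borel"
  moreover have "Y r \<in> borel_measurable (augmented_field T (\<PP> s x) r)"
    using assms unfolding adapted_cadlag_def by blast
  ultimately have "Y r -` A \<inter> space (augmented_field T (\<PP> s x) r) \<in> sets (augmented_field T (\<PP> s x) r)"
    by (rule measurable_sets[rotated])
  then show "Y r -` A \<inter> space (completion (\<PP> s x)) \<in> sets (completion (\<PP> s x))"
    using augmented_field_le_completion[OF s, of x r] space_PP[OF s, of x] by (simp, blast)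
qed simp

lemma window_measurable_PP:
  fixes f :: "(real \<Rightarrow> 'e) \<Rightarrow> real"
  assumes f: "f \<in> borel_measurable (window_field T t u)" and s: "s \<in> {0..T}" and "0 \<le> t" "u \<le> T"
  shows "f \<in> borel_measurable (\<PP> s x)"
proof (rule measurableI)
  fix A :: "real set" assume "A \<in> sets borel"
  then have "f -` A \<inter> path_space T \<in> sets (window_field T t u)"
    using measurable_sets[OF f] by simp
  then have "f -` A \<inter> path_space T \<in> sets (\<PP> s x)"
    using window_field_le[of t u T] assms by (intro sets_PP_if_coord_field[of s t]) auto
  then show "f -` A \<inter> space (\<PP> s x) \<in> sets (\<PP> s x)"
    by (simp add: space_PP[OF s])
qed simp

end

theorem proposition4p2:
  fixes T :: real
    and P :: "real \<Rightarrow> real \<Rightarrow> 'e::polish_space \<Rightarrow> 'e measure"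
    and \<PP> :: "real \<Rightarrow> 'e \<Rightarrow> (real \<Rightarrow> 'e) measure"
    and M :: "real \<Rightarrow> real \<Rightarrow> (real \<Rightarrow> 'e) \<Rightarrow> real"
    and Mcad :: "real \<Rightarrow> 'e \<Rightarrow> real \<Rightarrow> (real \<Rightarrow> 'e) \<Rightarrow> real"
    and QV :: "real \<Rightarrow> 'e \<Rightarrow> real \<Rightarrow> (real \<Rightarrow> 'e) \<Rightarrow> real"
  assumes "0 < T"
    and "transition_kernel T P"
    and "canonical_markov_class T P \<PP>"
    and "square_integrable_MAF T \<PP> M"
    and "\<And>s x. s \<in> {0..T} \<Longrightarrow> is_cadlag_version T \<PP> s x M (Mcad s x)"
    and "\<And>s x. s \<in> {0..T} \<Longrightarrow>
           is_quadratic_variation T (completion (\<PP> s x)) (augmented_field T (\<PP> s x))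
             (Mcad s x) (QV s x)"
  shows "\<exists>A. additive_functional T \<PP> A \<and>
           (\<forall>s\<in>{0..T}. \<forall>x. is_cadlag_version T \<PP> s x A (QV s x))"
proof -
  interpret markov_class T P \<PP>
    using assms(2,3) by unfold_locales
  have AF: "M t u \<in> borel_measurable (window_field T t u)" if "0 \<le> t" "t \<le> u" "u \<le> T" for t u
    using assms(4) that unfolding square_integrable_MAF_def additive_functional_def by blast
  note cad = assms(5) and qv = assms(6)
  have Mcad_meas: "Mcad s x r \<in> borel_measurable (completion (\<PP> s x))"
    if "s \<in> {0..T}" "r \<in> {0..T}" for s x r
    using cad[of s x] adapted_measurable_completion that unfolding is_cadlag_version_def by blast
  have QV_adapted: "adapted_cadlag T (completion (\<PP> s x)) (augmented_field T (\<PP> s x)) (QV s x)"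
    if "s \<in> {0..T}" for s x
    using qv[OF that] unfolding is_quadratic_variation_def by blast
  have QV_meas: "QV s x r \<in> borel_measurable (completion (\<PP> s x))"
    if "s \<in> {0..T}" "r \<in> {0..T}" for s x r
    using QV_adapted adapted_measurable_completion that by blast
  define k where "k t u = uniform_size t u" for t u
  define \<tau> where "\<tau> t u = uniform_point t u" for t u
  \<comment> \<open>In contrast to the sums of squares of \<open>Mcad s x\<close>, these sums do not depend on \<open>(s, x)\<close>.\<close>
  define S where "S t u n \<omega> = (\<Sum>i<k t u n. (M (\<tau> t u n i) (\<tau> t u n (Suc i)) \<omega>)\<^sup>2)" for t u n \<omega>
  have \<tau>: "vanishing_subdivisions t u (k t u) (\<tau> t u)" if "t \<le> u" for t u
    using vanishing_uniform[OF that] by (simp add: k_def \<tau>_def)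
  have points: "t \<le> \<tau> t u n i" "\<tau> t u n i \<le> \<tau> t u n (Suc i)" "\<tau> t u n (Suc i) \<le> u"
    if "t \<le> u" "i < k t u n" for t u n i
    using vanishing_subdivisions_in_interval[OF \<tau>[OF that(1)], of i n]
      vanishing_subdivisions_in_interval[OF \<tau>[OF that(1)], of "Suc i" n]
      vanishing_subdivisions_mono[OF \<tau>[OF that(1)], of "Suc i" n i] that(2) by auto
  have S_window: "S t u n \<in> borel_measurable (window_field T t u)"
    if tu: "0 \<le> t" "t \<le> u" "u \<le> T" for t u n
    unfolding S_def
  proof (rule borel_measurable_sum)
    fix i assume "i \<in> {..<k t u n}"
    then have i: "t \<le> \<tau> t u n i" "\<tau> t u n i \<le> \<tau> t u n (Suc i)" "\<tau> t u n (Suc i) \<le> u"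
      using points tu by auto
    have "M (\<tau> t u n i) (\<tau> t u n (Suc i)) \<in> borel_measurable (window_field T (\<tau> t u n i) (\<tau> t u n (Suc i)))"
      using i tu by (intro AF) auto
    then have [measurable]: "M (\<tau> t u n i) (\<tau> t u n (Suc i)) \<in> borel_measurable (window_field T t u)"
      using window_field_mono[OF tu(1) i(1,3) tu(3)] unfolding measurable_def by auto
    show "(\<lambda>\<omega>. (M (\<tau> t u n i) (\<tau> t u n (Suc i)) \<omega>)\<^sup>2) \<in> borel_measurable (window_field T t u)"
      by measurable
  qed
  have S_meas: "S t u n \<in> borel_measurable (\<PP> s x)"
    if "s \<in> {0..T}" "0 \<le> t" "t \<le> u" "u \<le> T" for s x t u n
    using that by (intro window_measurable_PP[OF S_window]) auto
  have S_lim: "tends_in_prob (completion (\<PP> s x)) (S t u) (\<lambda>\<omega>. QV s x u \<omega> - QV s x t \<omega>)"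
    if s: "s \<in> {0..t}" and tu: "t \<le> u" "u \<le> T" for s x t u
  proof -
    have sT: "s \<in> {0..T}" and t0: "0 \<le> t" and tT: "t \<in> {0..T}" "u \<in> {0..T}" using s tu by auto
    interpret C: prob_space "completion (\<PP> s x)"
      by (intro prob_space.prob_space_completion prob_space_PP sT)
    let ?Y = "Mcad s x"
    let ?S = "\<lambda>n \<omega>. \<Sum>i<k t u n. (?Y (\<tau> t u n (Suc i)) \<omega> - ?Y (\<tau> t u n i) \<omega>)\<^sup>2"
    have lim: "tends_in_prob (completion (\<PP> s x)) ?S (\<lambda>\<omega>. QV s x u \<omega> - QV s x t \<omega>)"
      by (rule C.quadratic_variation_increment[OF qv[OF sT] t0 tu])
        (auto intro: Mcad_meas QV_meas sT \<tau> tu)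
    have meas: "?S n \<in> borel_measurable (completion (\<PP> s x))" for n
    proof (rule borel_measurable_sum)
      fix i assume "i \<in> {..<k t u n}"
      then have [measurable]: "?Y (\<tau> t u n (Suc i)) \<in> borel_measurable (completion (\<PP> s x))"
        "?Y (\<tau> t u n i) \<in> borel_measurable (completion (\<PP> s x))"
        using points[OF tu(1), of i n] t0 tu by (auto intro!: Mcad_meas sT)
      show "(\<lambda>\<omega>. (?Y (\<tau> t u n (Suc i)) \<omega> - ?Y (\<tau> t u n i) \<omega>)\<^sup>2) \<in> borel_measurable (completion (\<PP> s x))"
        by measurable
    qed
    have eq: "AE \<omega> in completion (\<PP> s x). ?S n \<omega> = S t u n \<omega>" for n
    proof -
      have "AE \<omega> in completion (\<PP> s x). \<forall>i\<in>{..<k t u n}.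
          M (\<tau> t u n i) (\<tau> t u n (Suc i)) \<omega> = ?Y (\<tau> t u n (Suc i)) \<omega> - ?Y (\<tau> t u n i) \<omega>"
      proof (subst AE_ball_countable, simp, intro ballI)
        fix i assume "i \<in> {..<k t u n}"
        then have "s \<le> \<tau> t u n i \<and> \<tau> t u n i \<le> \<tau> t u n (Suc i) \<and> \<tau> t u n (Suc i) \<le> T"
          using points[OF tu(1), of i n] s tu by auto
        then show "AE \<omega> in completion (\<PP> s x).
            M (\<tau> t u n i) (\<tau> t u n (Suc i)) \<omega> = ?Y (\<tau> t u n (Suc i)) \<omega> - ?Y (\<tau> t u n i) \<omega>"
          using cad[OF sT, of x] unfolding is_cadlag_version_def by blast
      qed
      then show ?thesis by eventually_elim (simp add: S_def)
    qed
    have QV_diff: "(\<lambda>\<omega>. QV s x u \<omega> - QV s x t \<omega>) \<in> borel_measurable (completion (\<PP> s x))"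
      using QV_meas[OF sT tT(2)] QV_meas[OF sT tT(1)] by (rule borel_measurable_diff)
    show ?thesis
      by (rule C.tends_in_prob_AE_cong[OF meas _ QV_diff QV_diff eq AE_I2[OF refl] lim])
        (rule measurable_completion[OF S_meas[OF sT t0 tu]])
  qed
  \<comment> \<open>Under each law \<open>\<PP> t y\<close> the limit is the increment of \<open>QV t y\<close>.\<close>
  have A_ex: "\<exists>Z. Z \<in> borel_measurable (window_field T t u) \<and>
      (\<forall>s\<in>{0..t}. \<forall>x. tends_in_prob (\<PP> s x) (S t u) Z)"
    if tu: "0 \<le> t" "t \<le> u" "u \<le> T" for t u
  proof -
    have tT: "t \<in> {0..T}" "u \<in> {0..T}" using tu by auto
    have "\<exists>Z \<in> borel_measurable (window_field T t u). \<forall>s\<in>{0..t}. \<forall>x. tends_in_prob (\<PP> s x) (S t u) Z"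
    proof (rule common_limit_in_prob[OF tT(1)])
      fix y
      have "(\<lambda>\<omega>. QV t y u \<omega> - QV t y t \<omega>) \<in> borel_measurable (completion (\<PP> t y))"
        by (intro borel_measurable_diff QV_meas tT)
      then show "\<exists>Q \<in> borel_measurable (completion (\<PP> t y)). tends_in_prob (completion (\<PP> t y)) (S t u) Q"
        by (rule bexI[rotated]) (use S_lim[of t t u y] tu in simp)
    qed (use tu S_window window_field_le[of t u T] measurable_coord_window_field[of t u T] in simp_all)
    then show ?thesis by blast
  qed
  define A where "A t u = (SOME Z. Z \<in> borel_measurable (window_field T t u) \<and>
      (\<forall>s\<in>{0..t}. \<forall>x. tends_in_prob (\<PP> s x) (S t u) Z))" for t u
  have A: "A t u \<in> borel_measurable (window_field T t u)"
    and A_lim: "s \<in> {0..t} \<Longrightarrow> tends_in_prob (\<PP> s x) (S t u) (A t u)"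
    if "0 \<le> t" "t \<le> u" "u \<le> T" for t u s x
    using someI_ex[OF A_ex[OF that]] unfolding A_def by blast+
  have version: "is_cadlag_version T \<PP> s x A (QV s x)" if s: "s \<in> {0..T}" for s x
  proof -
    interpret P: prob_space "\<PP> s x" using s by (rule prob_space_PP)
    interpret C: prob_space "completion (\<PP> s x)" by (rule P.prob_space_completion)
    have "AE \<omega> in completion (\<PP> s x). \<forall>u\<in>{0..s}. QV s x u \<omega> = 0"
    proof (rule C.quadratic_variation_eq_0[OF qv[OF s] s])
      show "AE \<omega> in completion (\<PP> s x). \<forall>u\<in>{0..s}. Mcad s x u \<omega> = 0"
        using cad[OF s, of x] unfolding is_cadlag_version_def by blast
    qed (use s in \<open>auto intro: Mcad_meas QV_meas\<close>)
    moreover have "AE \<omega> in completion (\<PP> s x). A t u \<omega> = QV s x u \<omega> - QV s x t \<omega>"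
      if tu: "s \<le> t" "t \<le> u" "u \<le> T" for t u
    proof -
      have t0: "0 \<le> t" and tT: "t \<in> {0..T}" "u \<in> {0..T}" and st: "s \<in> {0..t}" using s tu by auto
      have AP: "A t u \<in> borel_measurable (\<PP> s x)"
        using A[OF t0 tu(2,3)] s t0 tu(3) by (rule window_measurable_PP)
      note SP = S_meas[OF s t0 tu(2,3), of _ x]
      have "tends_in_prob (completion (\<PP> s x)) (S t u) (A t u)"
        using A_lim[OF t0 tu(2,3) st, of x] P.tends_in_prob_completion_iff[OF SP AP] by simp
      then show ?thesis
        using S_lim[OF st tu(2,3), of x] s tT
        by (intro C.tends_in_prob_unique[OF measurable_completion[OF SP] measurable_completion[OF AP]]
            borel_measurable_diff QV_meas)
    qed
    ultimately show ?thesis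
      unfolding is_cadlag_version_def using QV_adapted[OF s] by blast
  qed
  then have "additive_functional T \<PP> A"
    unfolding additive_functional_def using A by blast
  then show ?thesis using version by blast
qed

end
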